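(* Let $p$ be a prime and let $(R, R^{+})$ be an analytic perfectoid pair in characteristic $p$, let $\overline{x}_0,\dots,\overline{x}_m\in R^+$ be generators of an ideal of definition of $R^+$, and let $\rho\in(0,1)$. Then the weighted Gauss norm \[ \Big|\sum_{n=0}^{\infty}p^{n}[\overline{y}_{n}] \Big|_{\rho} = \sup_{n\ge 0} \{ \rho^{n}|\overline{y}_{n}| \} \] on $W(R^{+})$ defines the $(p, [\overline{x}_{0}],\dots,[\overline{x}_{m}])$-adic topology.
   Context: A Huber ring is a complete topological ring $A$ with an open subring $A_0$ carrying the $I$-adic topology for a finitely generated ideal $I\subset A_0$. A uniform (power-bounded elements form a bounded set) analytic (topologically nilpotent elements generate the unit ideal) Huber pair $(A,A^+)$ is an analytic perfectoid pair if there is an ideal of definition $I\subset A^+$ with $p\in I^p$ and Frobenius $A^+/I\to A^+/I^p$ surjective. $R$ is perfect of characteristic $p$; it is regarded as a Banach ring with a power-multiplicative norm $|\cdot|$ defining its topology. $[\cdot]$ denotes the Teichmüller lift, and each element of $W(R^+)$ is uniquely $\sum_n p^n[\overline{y}_n]$ with $\overline{y}_n\in R^+$. *)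

theory Defs
  imports "HOL-Analysis.Analysis" "HOL-Library.Poly_Mapping" "HOL-Algebra.Algebra"
begin

section \<open>Topological rings and adic topologies\<close>

definition topological_cring :: "('a, 'm) ring_scheme \<Rightarrow> 'a topology \<Rightarrow> bool" where
  "topological_cring A T \<longleftrightarrow>
     cring A \<and> topspace T = carrier A \<and>
     continuous_map (prod_topology T T) T (\<lambda>(x, y). x \<oplus>\<^bsub>A\<^esub> y) \<and>
     continuous_map T T (\<lambda>x. \<ominus>\<^bsub>A\<^esub> x) \<and>
     continuous_map (prod_topology T T) T (\<lambda>(x, y). x \<otimes>\<^bsub>A\<^esub> y)"

definition cauchy_filter_on :: "('a, 'm) ring_scheme \<Rightarrow> 'a topology \<Rightarrow> 'a filter \<Rightarrow> bool" where
  "cauchy_filter_on A T F \<longleftrightarrow>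
     F \<noteq> bot \<and> F \<le> principal (carrier A) \<and>
     (\<forall>U. openin T U \<and> \<zero>\<^bsub>A\<^esub> \<in> U \<longrightarrow>
        (\<exists>S \<subseteq> carrier A. (\<forall>\<^sub>F x in F. x \<in> S) \<and> (\<forall>x\<in>S. \<forall>y\<in>S. x \<ominus>\<^bsub>A\<^esub> y \<in> U)))"

text \<open>As usual for Huber rings, completeness includes separatedness.\<close>

definition complete_topological_cring :: "('a, 'm) ring_scheme \<Rightarrow> 'a topology \<Rightarrow> bool" where
  "complete_topological_cring A T \<longleftrightarrow>
     topological_cring A T \<and> Hausdorff_space T \<and>
     (\<forall>F. cauchy_filter_on A T F \<longrightarrow> (\<exists>l. limitin T (\<lambda>x. x) l F))"

text \<open>Powers of an ideal are taken in the monoid \<^const>\<open>ideals_set\<close>;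
  the zeroth power is the whole ring.\<close>

definition adic_topology :: "('a, 'm) ring_scheme \<Rightarrow> 'a set \<Rightarrow> 'a topology" where
  "adic_topology A I =
     topology (\<lambda>U. U \<subseteq> carrier A \<and>
                   (\<forall>x\<in>U. \<exists>n::nat. x <+\<^bsub>A\<^esub> (I [^]\<^bsub>ideals_set A\<^esub> n) \<subseteq> U))"

definition fg_ideal :: "('a, 'm) ring_scheme \<Rightarrow> 'a set \<Rightarrow> bool" where
  "fg_ideal A I \<longleftrightarrow> (\<exists>S. finite S \<and> S \<subseteq> carrier A \<and> I = Idl\<^bsub>A\<^esub> S)"

abbreviation restrict_ring :: "('a, 'm) ring_scheme \<Rightarrow> 'a set \<Rightarrow> ('a, 'm) ring_scheme" where
  "restrict_ring A A0 \<equiv> A\<lparr>carrier := A0\<rparr>"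

definition ideal_of_definition ::
  "('a, 'm) ring_scheme \<Rightarrow> 'a topology \<Rightarrow> 'a set \<Rightarrow> 'a set \<Rightarrow> bool" where
  "ideal_of_definition A T A0 I \<longleftrightarrow>
     fg_ideal (restrict_ring A A0) I \<and>
     subtopology T A0 = adic_topology (restrict_ring A A0) I"

section \<open>Huber rings and perfectoid pairs\<close>

definition huber_ring :: "('a, 'm) ring_scheme \<Rightarrow> 'a topology \<Rightarrow> bool" where
  "huber_ring A T \<longleftrightarrow>
     complete_topological_cring A T \<and>
     (\<exists>A0 I. subring A0 A \<and> openin T A0 \<and> ideal_of_definition A T A0 I)"

definition bounded_in :: "('a, 'm) ring_scheme \<Rightarrow> 'a topology \<Rightarrow> 'a set \<Rightarrow> bool" where
  "bounded_in A T S \<longleftrightarrow>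
     S \<subseteq> carrier A \<and>
     (\<forall>U. openin T U \<and> \<zero>\<^bsub>A\<^esub> \<in> U \<longrightarrow>
        (\<exists>V. openin T V \<and> \<zero>\<^bsub>A\<^esub> \<in> V \<and> (\<forall>v\<in>V. \<forall>s\<in>S. v \<otimes>\<^bsub>A\<^esub> s \<in> U)))"

definition power_bounded_elements :: "('a, 'm) ring_scheme \<Rightarrow> 'a topology \<Rightarrow> 'a set" where
  "power_bounded_elements A T =
     {a \<in> carrier A. bounded_in A T (range (\<lambda>n::nat. a [^]\<^bsub>A\<^esub> n))}"

definition topologically_nilpotent_elements :: "('a, 'm) ring_scheme \<Rightarrow> 'a topology \<Rightarrow> 'a set" where
  "topologically_nilpotent_elements A T =
     {a \<in> carrier A. limitin T (\<lambda>n::nat. a [^]\<^bsub>A\<^esub> n) \<zero>\<^bsub>A\<^esub> sequentially}"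

definition uniform_ring :: "('a, 'm) ring_scheme \<Rightarrow> 'a topology \<Rightarrow> bool" where
  "uniform_ring A T \<longleftrightarrow> bounded_in A T (power_bounded_elements A T)"

definition analytic_ring :: "('a, 'm) ring_scheme \<Rightarrow> 'a topology \<Rightarrow> bool" where
  "analytic_ring A T \<longleftrightarrow> Idl\<^bsub>A\<^esub> (topologically_nilpotent_elements A T) = carrier A"

definition integral_over :: "('a, 'm) ring_scheme \<Rightarrow> 'a set \<Rightarrow> 'a \<Rightarrow> bool" where
  "integral_over A B x \<longleftrightarrow>
     (\<exists>(n::nat) c. (\<forall>i<n. c i \<in> B) \<and>
        x [^]\<^bsub>A\<^esub> n \<oplus>\<^bsub>A\<^esub> (\<Oplus>\<^bsub>A\<^esub>i\<in>{..<n}. c i \<otimes>\<^bsub>A\<^esub> x [^]\<^bsub>A\<^esub> i) = \<zero>\<^bsub>A\<^esub>)"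

definition huber_pair :: "('a, 'm) ring_scheme \<Rightarrow> 'a topology \<Rightarrow> 'a set \<Rightarrow> bool" where
  "huber_pair A T Aplus \<longleftrightarrow>
     huber_ring A T \<and> subring Aplus A \<and> openin T Aplus \<and>
     Aplus \<subseteq> power_bounded_elements A T \<and>
     (\<forall>x\<in>carrier A. integral_over A Aplus x \<longrightarrow> x \<in> Aplus)"

text \<open>The map \<open>B/I \<rightarrow> B/I\<^sup>p\<close> induced by \<open>z \<mapsto> z\<^sup>p\<close>. If \<open>p \<in> I\<^sup>p\<close>, the cosets in the
  union all coincide.\<close>

definition frobenius_mod :: "nat \<Rightarrow> ('a, 'm) ring_scheme \<Rightarrow> 'a set \<Rightarrow> 'a set \<Rightarrow> 'a set" where
  "frobenius_mod p B I C = (\<Union>z\<in>C. (I [^]\<^bsub>ideals_set B\<^esub> p) +>\<^bsub>B\<^esub> (z [^]\<^bsub>B\<^esub> p))"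

definition analytic_perfectoid_pair ::
  "nat \<Rightarrow> ('a, 'm) ring_scheme \<Rightarrow> 'a topology \<Rightarrow> 'a set \<Rightarrow> bool" where
  "analytic_perfectoid_pair p A T Aplus \<longleftrightarrow>
     huber_pair A T Aplus \<and> uniform_ring A T \<and> analytic_ring A T \<and>
     (\<exists>I. ideal_of_definition A T Aplus I \<and>
        (let B = restrict_ring A Aplus; Ip = I [^]\<^bsub>ideals_set B\<^esub> p in
           add_pow B p \<one>\<^bsub>B\<^esub> \<in> Ip \<and>
           frobenius_mod p B I ` carrier (B Quot I) = carrier (B Quot Ip)))"

section \<open>Norms\<close>

text \<open>The value outside the carrier is irrelevant; it is set to \<open>0\<close> because the locale
  \<^const>\<open>Metric_space\<close> requires symmetry and nonnegativity on the whole type.\<close>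

definition norm_dist :: "('a, 'm) ring_scheme \<Rightarrow> ('a \<Rightarrow> real) \<Rightarrow> 'a \<Rightarrow> 'a \<Rightarrow> real" where
  "norm_dist A N x y = (if x \<in> carrier A \<and> y \<in> carrier A then N (x \<ominus>\<^bsub>A\<^esub> y) else 0)"

definition norm_topology :: "('a, 'm) ring_scheme \<Rightarrow> ('a \<Rightarrow> real) \<Rightarrow> 'a topology" where
  "norm_topology A N = Metric_space.mtopology (carrier A) (norm_dist A N)"

definition banach_ring_norm :: "('a, 'm) ring_scheme \<Rightarrow> ('a \<Rightarrow> real) \<Rightarrow> bool" where
  "banach_ring_norm A N \<longleftrightarrow>
     (\<forall>x\<in>carrier A. 0 \<le> N x \<and> (N x = 0 \<longleftrightarrow> x = \<zero>\<^bsub>A\<^esub>)) \<and>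
     (\<forall>x\<in>carrier A. \<forall>y\<in>carrier A. N (x \<ominus>\<^bsub>A\<^esub> y) \<le> max (N x) (N y)) \<and>
     (\<forall>x\<in>carrier A. \<forall>y\<in>carrier A. N (x \<otimes>\<^bsub>A\<^esub> y) \<le> N x * N y) \<and>
     Metric_space.mcomplete (carrier A) (norm_dist A N)"

definition power_multiplicative_norm :: "('a, 'm) ring_scheme \<Rightarrow> ('a \<Rightarrow> real) \<Rightarrow> bool" where
  "power_multiplicative_norm A N \<longleftrightarrow>
     (\<forall>x\<in>carrier A. \<forall>n::nat. n > 0 \<longrightarrow> N (x [^]\<^bsub>A\<^esub> n) = N x ^ n)"

section \<open>Witt vectors\<close>

text \<open>Integer polynomials in two families of variables \<open>X\<^sub>i\<close> (index \<^term>\<open>Inl i\<close>) and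
  \<open>Y\<^sub>i\<close> (index \<^term>\<open>Inr i\<close>).\<close>

type_synonym witt_poly = "((nat + nat) \<Rightarrow>\<^sub>0 nat) \<Rightarrow>\<^sub>0 int"

definition witt_var :: "nat + nat \<Rightarrow> witt_poly" where
  "witt_var v = Poly_Mapping.single (Poly_Mapping.single v 1) 1"

definition ghost :: "nat \<Rightarrow> (nat \<Rightarrow> witt_poly) \<Rightarrow> nat \<Rightarrow> witt_poly" where
  "ghost p S n = (\<Sum>i\<le>n. of_nat (p ^ i) * S i ^ (p ^ (n - i)))"

text \<open>The universal polynomials describing addition and multiplication of \<open>p\<close>-typical Witt
  vectors: the unique integral polynomials for which the ghost components are additive,
  respectively multiplicative.\<close>

definition witt_add_poly :: "nat \<Rightarrow> nat \<Rightarrow> witt_poly" where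
  "witt_add_poly p = (THE S. \<forall>n. ghost p S n =
     ghost p (\<lambda>i. witt_var (Inl i)) n + ghost p (\<lambda>i. witt_var (Inr i)) n)"

definition witt_mult_poly :: "nat \<Rightarrow> nat \<Rightarrow> witt_poly" where
  "witt_mult_poly p = (THE S. \<forall>n. ghost p S n =
     ghost p (\<lambda>i. witt_var (Inl i)) n * ghost p (\<lambda>i. witt_var (Inr i)) n)"

definition eval_witt_poly :: "('a, 'm) ring_scheme \<Rightarrow> (nat + nat \<Rightarrow> 'a) \<Rightarrow> witt_poly \<Rightarrow> 'a" where
  "eval_witt_poly A f P =
     (\<Oplus>\<^bsub>A\<^esub>m\<in>Poly_Mapping.keys P. add_pow A (Poly_Mapping.lookup P m)
        (\<Otimes>\<^bsub>A\<^esub>v\<in>Poly_Mapping.keys m. f v [^]\<^bsub>A\<^esub> Poly_Mapping.lookup m v))"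

definition teichmuller :: "('a, 'm) ring_scheme \<Rightarrow> 'a \<Rightarrow> nat \<Rightarrow> 'a" where
  "teichmuller A x = (\<lambda>n. if n = 0 then x else \<zero>\<^bsub>A\<^esub>)"

definition witt_ring :: "nat \<Rightarrow> ('a, 'm) ring_scheme \<Rightarrow> (nat \<Rightarrow> 'a) ring" where
  "witt_ring p A =
     \<lparr>carrier = {a. \<forall>n. a n \<in> carrier A},
      mult = (\<lambda>a b n. eval_witt_poly A (case_sum a b) (witt_mult_poly p n)),
      one = teichmuller A \<one>\<^bsub>A\<^esub>,
      ring.zero = (\<lambda>_. \<zero>\<^bsub>A\<^esub>),
      add = (\<lambda>a b n. eval_witt_poly A (case_sum a b) (witt_add_poly p n))\<rparr>"

text \<open>\<open>w = \<Sum>\<^sub>n p\<^sup>n [y\<^sub>n]\<close>, the sum being \<open>p\<close>-adically convergent. The \<open>y\<^sub>n\<close> differ from the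
  Witt components \<open>w n\<close> by \<open>p\<^sup>n\<close>-th powers.\<close>

definition teichmuller_expansion ::
  "nat \<Rightarrow> ('a, 'm) ring_scheme \<Rightarrow> (nat \<Rightarrow> 'a) \<Rightarrow> (nat \<Rightarrow> 'a) \<Rightarrow> bool" where
  "teichmuller_expansion p A w y \<longleftrightarrow>
     (\<forall>n. y n \<in> carrier A) \<and>
     (let W = witt_ring p A in
        limitin (adic_topology W (Idl\<^bsub>W\<^esub> {add_pow W p \<one>\<^bsub>W\<^esub>}))
          (\<lambda>k. \<Oplus>\<^bsub>W\<^esub>n\<in>{..<k}. add_pow W (p ^ n) (teichmuller A (y n))) w sequentially)"

definition gauss_norm ::
  "nat \<Rightarrow> ('a, 'm) ring_scheme \<Rightarrow> ('a \<Rightarrow> real) \<Rightarrow> real \<Rightarrow> (nat \<Rightarrow> 'a) \<Rightarrow> real" where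
  "gauss_norm p A N \<rho> w =
     (let y = (THE y. teichmuller_expansion p A w y) in (SUP n. \<rho> ^ n * N (y n)))"

end

theory Submission
  imports Defs "HOL-Decision_Procs.Algebra_Aux"
begin

text \<open>
  Identities in \<open>W(R\<^sup>+)\<close> are checked on ghost components after lifting to Witt vectors over the
  torsion-free ring \<open>\<int>[X\<^sub>b | b \<in> R\<^sup>+]\<close>, where congruent ghost components have congruent
  Witt components. The Witt addition polynomials are isobaric, which makes the Gauss norm
  ultrametric; submultiplicativity follows from \<open>a b = [a\<^sub>0] b + p (a' b)\<close> for
  \<open>a = [a\<^sub>0] + p a'\<close>.

  Let \<open>J = (p, [x\<^sub>0], \<dots>, [x\<^sub>m])\<close>. The generators have Gauss norm at most some \<open>c < 1\<close>, so
  \<open>J\<^sup>k\<close> lies in the ball of radius \<open>c\<^sup>k\<close>. Conversely, if \<open>y \<in> R\<^sup>+\<close> is small, then so is its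
  root \<open>z\<close> of order \<open>q = p\<^sup>k\<close>; hence \<open>z \<in> (x\<^sub>0, \<dots>, x\<^sub>m)\<close>, \<open>[z] \<in> J\<close>, and
  \<open>[y] = [z]\<^sup>q \<in> J\<^sup>k\<close>. Applied to the first \<open>k\<close> Teichmueller coefficients of \<open>w\<close>, this puts every
  \<open>w\<close> of small Gauss norm into \<open>J\<^sup>k\<close>.

  Perfectness of \<open>R\<^sup>+\<close>: surjectivity of Frobenius modulo \<open>I\<^sup>p\<close> makes the \<open>p\<close>-th powers an
  \<open>I\<close>-adically dense subring, and in a complete power-multiplicative norm the \<open>p\<close>-th powers
  are closed. The norm is at most \<open>1\<close> on \<open>R\<^sup>+\<close> because bounded sets are norm bounded: the elements
  with a power that multiplies a bounded set into some ball form an ideal, which contains the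
  topologically nilpotent elements and hence \<open>1\<close>.
\<close>

subsection \<open>Ghost components\<close>

lemma prime_dvd_power_add_diff:
  fixes x y :: "'r::comm_ring_1"
  assumes "Factorial_Ring.prime (p::nat)"
  shows "of_nat p dvd (x + y) ^ p - (x ^ p + y ^ p)"
proof -
  let ?f = "\<lambda>k. of_nat (p choose k) * x ^ k * y ^ (p - k)"
  have "p > 0" using assms by (rule prime_gt_0_nat)
  then have "{..p} = insert 0 (insert p {0<..<p})" by auto
  then have "(x + y) ^ p = ?f 0 + (?f p + (\<Sum>k\<in>{0<..<p}. ?f k))"
    using \<open>p > 0\<close> by (simp add: binomial_ring)
  then have "(x + y) ^ p - (x ^ p + y ^ p) = (\<Sum>k\<in>{0<..<p}. ?f k)" by simp
  also have "of_nat p dvd \<dots>"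
  proof (rule dvd_sum)
    fix k assume "k \<in> {0<..<p}"
    then have "p dvd (p choose k)" using assms by (intro dvd_choose_prime) auto
    then have "(of_nat p :: 'r) dvd of_nat (p choose k)" by (metis dvdE dvd_triv_left of_nat_mult)
    then show "of_nat p dvd ?f k" by (simp add: dvd_mult2)
  qed
  finally show ?thesis .
qed

lemma dvd_power_diff_power:
  fixes x y :: "'r::comm_ring_1"
  assumes "d dvd x - y" "of_nat p dvd x - y"
  shows "d * of_nat p dvd x ^ p - y ^ p"
proof -
  let ?s = "\<Sum>i<p. y ^ (p - Suc i) * x ^ i"
  have "of_nat p dvd y ^ (p - Suc i) * x ^ i - y ^ (p - Suc i) * y ^ i" for i
    by (metis assms(2) dvd_mult dvd_trans dvd_triv_left power_diff_sumr2 right_diff_distrib)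
  then have "of_nat p dvd ?s - (\<Sum>i<p. y ^ (p - Suc i) * y ^ i)"
    unfolding sum_subtractf[symmetric] by (rule dvd_sum)
  moreover have "(\<Sum>i<p. y ^ (p - Suc i) * y ^ i) = of_nat p * y ^ (p - 1)"
    by (simp flip: power_add)
  ultimately have "of_nat p dvd ?s" by (simp add: dvd_diff_left_iff)
  with assms(1) have "d * of_nat p dvd (x - y) * ?s" by (rule mult_dvd_mono)
  then show ?thesis by (simp add: power_diff_sumr2)
qed

lemma power_Suc_dvd_power_diff_power:
  fixes x y :: "'r::comm_ring_1"
  assumes "of_nat p dvd x - y"
  shows "of_nat p ^ Suc k dvd x ^ (p ^ k) - y ^ (p ^ k)"
proof (induction k)
  case (Suc k)
  have "of_nat p dvd x ^ (p ^ k) - y ^ (p ^ k)"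
    using Suc by (rule dvd_trans[rotated]) simp
  with Suc have "of_nat p ^ Suc k * of_nat p dvd (x ^ (p ^ k)) ^ p - (y ^ (p ^ k)) ^ p"
    by (rule dvd_power_diff_power)
  then show ?case by (simp add: mult_ac flip: power_mult)
qed (use assms in simp)

definition lower_ghost_sum :: "nat \<Rightarrow> (nat \<Rightarrow> 'r::comm_ring_1) \<Rightarrow> nat \<Rightarrow> 'r" where
  "lower_ghost_sum p a n = (\<Sum>i<n. of_nat p ^ i * a i ^ (p ^ (n - i)))"

definition ghost_component :: "nat \<Rightarrow> (nat \<Rightarrow> 'r::comm_ring_1) \<Rightarrow> nat \<Rightarrow> 'r" where
  "ghost_component p a n = (\<Sum>i\<le>n. of_nat p ^ i * a i ^ (p ^ (n - i)))"

lemma ghost_component_eq: "ghost_component p a n = lower_ghost_sum p a n + of_nat p ^ n * a n"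
  by (simp add: ghost_component_def lower_ghost_sum_def lessThan_Suc_atMost[symmetric])

lemma lower_ghost_sum_Suc:
  "lower_ghost_sum p a (Suc n) = ghost_component p (\<lambda>i. a i ^ p) n"
  unfolding lower_ghost_sum_def ghost_component_def lessThan_Suc_atMost
  by (intro sum.cong) (auto simp: Suc_diff_le simp flip: power_mult)

lemma power_dvd_ghost_summand_diff:
  fixes x y :: "'r::comm_ring_1"
  assumes "of_nat p dvd x - y" "i \<le> n"
  shows "of_nat p ^ Suc n dvd of_nat p ^ i * x ^ (p ^ (n - i)) - of_nat p ^ i * y ^ (p ^ (n - i))"
proof -
  have "of_nat p ^ i * of_nat p ^ Suc (n - i) dvd
      of_nat p ^ i * (x ^ (p ^ (n - i)) - y ^ (p ^ (n - i)))"
    using assms(1) by (intro mult_dvd_mono power_Suc_dvd_power_diff_power) simp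
  moreover have "of_nat p ^ i * of_nat p ^ Suc (n - i) = (of_nat p ^ Suc n :: 'r)"
    using assms(2) by (simp only: flip: power_add) simp
  ultimately show ?thesis by (simp add: right_diff_distrib)
qed

lemma power_dvd_lower_ghost_sum_diff:
  fixes a b :: "nat \<Rightarrow> 'r::comm_ring_1"
  assumes "\<And>i. i < n \<Longrightarrow> of_nat p dvd a i - b i"
  shows "of_nat p ^ Suc n dvd lower_ghost_sum p a n - lower_ghost_sum p b n"
  unfolding lower_ghost_sum_def sum_subtractf[symmetric]
  using assms by (intro dvd_sum power_dvd_ghost_summand_diff) auto

lemma power_dvd_ghost_component_diff:
  fixes a b :: "nat \<Rightarrow> 'r::comm_ring_1"
  assumes "\<And>i. of_nat p dvd a i - b i"
  shows "of_nat p ^ Suc n dvd ghost_component p a n - ghost_component p b n"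
  unfolding ghost_component_def sum_subtractf[symmetric]
  using assms by (intro dvd_sum power_dvd_ghost_summand_diff) auto

context
  fixes p :: nat
  assumes torsion_free: "\<And>x::'r::comm_ring_1. of_nat p * x = 0 \<Longrightarrow> x = 0"
begin

lemma of_nat_power_mult_cancel:
  fixes x y :: 'r
  shows "of_nat p ^ n * x = of_nat p ^ n * y \<longleftrightarrow> x = y"
proof (induction n)
  case (Suc n)
  have "of_nat p * (of_nat p ^ n * x - of_nat p ^ n * y) = 0"
    if "of_nat p ^ Suc n * x = of_nat p ^ Suc n * y"
    using that by (simp add: algebra_simps)
  then show ?case using Suc torsion_free by fastforce
qed simp

lemma components_dvd_diff_if_ghost_components:
  fixes a b :: "nat \<Rightarrow> 'r"
  assumes ghost: "\<And>n. of_nat p ^ Suc n dvd ghost_component p a n - ghost_component p b n"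
  shows "of_nat p dvd a n - b n"
proof (induction n rule: less_induct)
  case (less n)
  then have "of_nat p ^ Suc n dvd (ghost_component p a n - ghost_component p b n) -
      (lower_ghost_sum p a n - lower_ghost_sum p b n)"
    by (intro dvd_diff[OF ghost] power_dvd_lower_ghost_sum_diff)
  also have "\<dots> = of_nat p ^ n * (a n - b n)"
    by (simp add: ghost_component_eq algebra_simps)
  finally obtain d where "of_nat p ^ n * (a n - b n) = of_nat p ^ n * (of_nat p * d)"
    by (auto elim!: dvdE simp: mult_ac)
  then show ?case by (simp only: of_nat_power_mult_cancel dvd_triv_left)
qed

lemma ghost_component_inj:
  fixes a b :: "nat \<Rightarrow> 'r"
  assumes "ghost_component p a = ghost_component p b"
  shows "a = b"
proof
  fix n show "a n = b n"
  proof (induction n rule: less_induct)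
    case (less n)
    then have "lower_ghost_sum p a n = lower_ghost_sum p b n" by (simp add: lower_ghost_sum_def)
    then have "of_nat p ^ n * a n = of_nat p ^ n * b n"
      using fun_cong[OF assms, of n] by (simp add: ghost_component_eq)
    then show ?case by (simp only: of_nat_power_mult_cancel)
  qed
qed

end

locale comm_ring_hom =
  fixes h :: "'r::comm_ring_1 \<Rightarrow> 's::comm_ring_1"
  assumes hom_add: "h (x + y) = h x + h y"
    and hom_mult: "h (x * y) = h x * h y"
    and hom_one: "h 1 = 1"
begin

lemma hom_zero: "h 0 = 0"
  using hom_add[of 0 0] by simp

lemma hom_diff: "h (x - y) = h x - h y"
  using hom_add[of "x - y" y] by simp

lemma hom_uminus: "h (- x) = - h x"
  using hom_diff[of 0 x] by (simp add: hom_zero)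

lemma hom_power: "h (x ^ n) = h x ^ n"
  by (induction n) (simp_all add: hom_one hom_mult)

lemma hom_of_nat: "h (of_nat n) = of_nat n"
  by (induction n) (simp_all add: hom_zero hom_one hom_add)

lemma hom_sum: "h (sum f I) = (\<Sum>i\<in>I. h (f i))"
  by (induction I rule: infinite_finite_induct) (simp_all add: hom_zero hom_add)

lemma hom_ghost_component: "h (ghost_component p a n) = ghost_component p (\<lambda>i. h (a i)) n"
  by (simp add: ghost_component_def hom_sum hom_mult hom_power hom_of_nat)

end

subsection \<open>Dwork's criterion\<close>

text \<open>The witness \<open>r\<close> exists only if the division by \<open>p\<^sup>n\<close> is possible, as it is for the Dwork
  sequences below.\<close>

fun ghost_inverse :: "nat \<Rightarrow> (nat \<Rightarrow> 'r::comm_ring_1) \<Rightarrow> nat \<Rightarrow> 'r" where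
  "ghost_inverse p t n =
     (SOME r. of_nat p ^ n * r = t n - (\<Sum>i<n. of_nat p ^ i * ghost_inverse p t i ^ (p ^ (n - i))))"

declare ghost_inverse.simps [simp del]

lemma ghost_component_ghost_inverse_if_dvd:
  assumes "of_nat p ^ n dvd t n - lower_ghost_sum p (ghost_inverse p t) n"
  shows "ghost_component p (ghost_inverse p t) n = t n"
proof -
  have "\<exists>r. of_nat p ^ n * r = t n - lower_ghost_sum p (ghost_inverse p t) n"
    using assms by (metis dvdE)
  from someI_ex[OF this] show ?thesis
    by (simp add: ghost_component_eq lower_ghost_sum_def ghost_inverse.simps[of p t n])
qed

locale frobenius_lift = comm_ring_hom \<phi>
  for \<phi> :: "'r::comm_ring_1 \<Rightarrow> 'r" +
  fixes p :: nat
  assumes lift_cong: "of_nat p dvd \<phi> x - x ^ p"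
begin

definition dwork_sequence :: "(nat \<Rightarrow> 'r) \<Rightarrow> bool" where
  "dwork_sequence t \<longleftrightarrow> (\<forall>n. of_nat p ^ Suc n dvd t (Suc n) - \<phi> (t n))"

lemma dwork_sequenceD: "dwork_sequence t \<Longrightarrow> of_nat p ^ Suc n dvd t (Suc n) - \<phi> (t n)"
  by (simp add: dwork_sequence_def)

lemma power_dvd_lift_ghost_component_diff:
  "of_nat p ^ Suc n dvd \<phi> (ghost_component p a n) - lower_ghost_sum p a (Suc n)"
  unfolding hom_ghost_component lower_ghost_sum_Suc
  by (intro power_dvd_ghost_component_diff lift_cong)

lemma ghost_component_ghost_inverse:
  assumes "dwork_sequence t"
  shows "ghost_component p (ghost_inverse p t) n = t n"
proof (induction n)
  case 0
  show ?case by (rule ghost_component_ghost_inverse_if_dvd) simp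
next
  case (Suc n)
  have "of_nat p ^ Suc n dvd (t (Suc n) - \<phi> (t n)) +
      (\<phi> (t n) - lower_ghost_sum p (ghost_inverse p t) (Suc n))"
    using power_dvd_lift_ghost_component_diff[of n "ghost_inverse p t"] unfolding Suc
    by (intro dvd_add dwork_sequenceD[OF assms])
  then show ?case by (intro ghost_component_ghost_inverse_if_dvd) simp
qed

lemma dwork_sequence_ghost_component: "dwork_sequence (ghost_component p a)"
  unfolding dwork_sequence_def
proof
  fix n
  have "of_nat p ^ Suc n dvd of_nat p ^ Suc n * a (Suc n) -
      (\<phi> (ghost_component p a n) - lower_ghost_sum p a (Suc n))"
    by (intro dvd_diff power_dvd_lift_ghost_component_diff dvd_triv_left)
  then show "of_nat p ^ Suc n dvd ghost_component p a (Suc n) - \<phi> (ghost_component p a n)"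
    by (simp add: ghost_component_eq[of p a "Suc n"] algebra_simps)
qed

lemma dwork_sequence_add:
  assumes "dwork_sequence s" "dwork_sequence t"
  shows "dwork_sequence (\<lambda>n. s n + t n)"
  unfolding dwork_sequence_def hom_add add_diff_add
  using assms by (intro allI dvd_add dwork_sequenceD)

lemma dwork_sequence_uminus:
  assumes "dwork_sequence s"
  shows "dwork_sequence (\<lambda>n. - s n)"
proof -
  have "- s (Suc n) - \<phi> (- s n) = - (s (Suc n) - \<phi> (s n))" for n by (simp add: hom_uminus)
  then show ?thesis using assms by (simp only: dwork_sequence_def dvd_minus_iff simp_thms)
qed

lemma dwork_sequence_mult:
  assumes "dwork_sequence s" "dwork_sequence t"
  shows "dwork_sequence (\<lambda>n. s n * t n)"
  unfolding dwork_sequence_def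
proof
  fix n
  have "s (Suc n) * t (Suc n) - \<phi> (s n * t n) =
      (s (Suc n) - \<phi> (s n)) * t (Suc n) + \<phi> (s n) * (t (Suc n) - \<phi> (t n))"
    by (simp add: hom_mult algebra_simps)
  also have "of_nat p ^ Suc n dvd \<dots>"
    by (intro dvd_add dvd_mult dvd_mult2 dwork_sequenceD assms)
  finally show "of_nat p ^ Suc n dvd s (Suc n) * t (Suc n) - \<phi> (s n * t n)" .
qed

end

subsection \<open>Evaluation of integral polynomials\<close>

type_synonym 'v zpoly = "('v \<Rightarrow>\<^sub>0 nat) \<Rightarrow>\<^sub>0 int"

definition zvar :: "'v \<Rightarrow> 'v zpoly" where
  "zvar v = frag_of (Poly_Mapping.single v 1)"

lemma zvar_power: "zvar v ^ k = frag_of (Poly_Mapping.single v k)"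
  by (induction k) (simp_all add: zvar_def mult_single flip: single_add)

lemma zpoly_induct [case_names one var diff mult]:
  fixes P :: "'v zpoly"
  assumes one: "Q 1" and var: "\<And>v. Q (zvar v)"
    and diff: "\<And>P P'. Q P \<Longrightarrow> Q P' \<Longrightarrow> Q (P - P')" and mult: "\<And>P P'. Q P \<Longrightarrow> Q P' \<Longrightarrow> Q (P * P')"
  shows "Q P"
proof -
  have "Q (frag_of m)" for m :: "'v \<Rightarrow>\<^sub>0 nat"
  proof (induction m rule: update_induct)
    case const
    show ?case using one by simp
  next
    case (update m v k)
    have "Poly_Mapping.update v k m = Poly_Mapping.single v k + m"
      using update(1)
      by (intro poly_mapping_eqI) (auto simp: lookup_update lookup_add lookup_single in_keys_iff)
    then have "frag_of (Poly_Mapping.update v k m) = zvar v ^ k * frag_of m"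
      by (simp add: zvar_power mult_single)
    moreover have "Q (zvar v ^ k)" by (induction k) (simp_all add: one var mult)
    ultimately show ?case using update.IH by (simp add: mult)
  qed
  then show ?thesis
    using diff[OF one one] diff by (induction P rule: frag_induction[OF subset_UNIV]) simp_all
qed

lemma of_nat_mult_zpoly: "of_nat k * (P :: 'v zpoly) = frag_cmul (int k) P"
  by (induction k) (simp_all add: distrib_right frag_cmul_distrib)

lemma zpoly_torsion_free: "0 < p \<Longrightarrow> of_nat p * (P :: 'v zpoly) = 0 \<Longrightarrow> P = 0"
  by (simp add: of_nat_mult_zpoly)

definition zmon :: "('a, 'm) ring_scheme \<Rightarrow> ('v \<Rightarrow> 'a) \<Rightarrow> ('v \<Rightarrow>\<^sub>0 nat) \<Rightarrow> 'a" where
  "zmon A f m = (\<Otimes>\<^bsub>A\<^esub>v\<in>Poly_Mapping.keys m. f v [^]\<^bsub>A\<^esub> Poly_Mapping.lookup m v)"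

definition zeval :: "('a, 'm) ring_scheme \<Rightarrow> ('v \<Rightarrow> 'a) \<Rightarrow> 'v zpoly \<Rightarrow> 'a" where
  "zeval A f P =
     (\<Oplus>\<^bsub>A\<^esub>m\<in>Poly_Mapping.keys P. add_pow A (Poly_Mapping.lookup P m) (zmon A f m))"

lemma eval_witt_poly_eq_zeval: "eval_witt_poly A f P = zeval A f P"
  by (simp add: eval_witt_poly_def zeval_def zmon_def)

context cring begin

lemma add_pow_int_0: "add_pow R (0::int) x = \<zero>"
  by (simp add: add_pow_def)

context
  fixes f :: "'v \<Rightarrow> 'a"
  assumes f: "\<And>v. f v \<in> carrier R"
begin

lemma zmon_closed [simp]: "zmon R f m \<in> carrier R"
  unfolding zmon_def by (intro finprod_closed) (auto simp: f)

lemma zmon_superset: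
  assumes "finite V" "Poly_Mapping.keys m \<subseteq> V"
  shows "zmon R f m = (\<Otimes>v\<in>V. f v [^] Poly_Mapping.lookup m v)"
  unfolding zmon_def using assms
  by (intro finprod_mono_neutral_cong_left) (auto simp: f in_keys_iff)

lemma zmon_add: "zmon R f (m + m') = zmon R f m \<otimes> zmon R f m'"
proof -
  let ?V = "Poly_Mapping.keys m \<union> Poly_Mapping.keys m'"
  have "zmon R f (m + m') = (\<Otimes>v\<in>?V. f v [^] Poly_Mapping.lookup (m + m') v)"
    by (rule zmon_superset) (auto simp: keys_add)
  also have "\<dots> = (\<Otimes>v\<in>?V. f v [^] Poly_Mapping.lookup m v \<otimes> f v [^] Poly_Mapping.lookup m' v)"
    by (simp add: lookup_add nat_pow_mult f)
  also have "\<dots> = zmon R f m \<otimes> zmon R f m'"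
    by (simp add: zmon_superset[of ?V] f finprod_multf)
  finally show ?thesis .
qed

lemma zeval_closed [simp]: "zeval R f P \<in> carrier R"
  unfolding zeval_def by (intro finsum_closed) auto

lemma zeval_superset:
  assumes "finite M" "Poly_Mapping.keys P \<subseteq> M"
  shows "zeval R f P = (\<Oplus>m\<in>M. add_pow R (Poly_Mapping.lookup P m) (zmon R f m))"
  unfolding zeval_def using assms
  by (intro add.finprod_mono_neutral_cong_left) (auto simp: in_keys_iff add_pow_int_0)

lemma zeval_add: "zeval R f (P + Q) = zeval R f P \<oplus> zeval R f Q"
proof -
  let ?M = "Poly_Mapping.keys P \<union> Poly_Mapping.keys Q"
  have "zeval R f (P + Q) = (\<Oplus>m\<in>?M. add_pow R (Poly_Mapping.lookup (P + Q) m) (zmon R f m))"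
    by (rule zeval_superset) (auto simp: keys_add)
  also have "\<dots> = (\<Oplus>m\<in>?M. add_pow R (Poly_Mapping.lookup P m) (zmon R f m)
                         \<oplus> add_pow R (Poly_Mapping.lookup Q m) (zmon R f m))"
    by (simp add: lookup_add add.int_pow_mult)
  also have "\<dots> = zeval R f P \<oplus> zeval R f Q"
    by (simp add: zeval_superset[of ?M] finsum_addf)
  finally show ?thesis .
qed

lemma zeval_zero: "zeval R f 0 = \<zero>"
  by (simp add: zeval_def)

lemma zeval_diff: "zeval R f (P - Q) = zeval R f P \<ominus> zeval R f Q"
proof -
  have "zeval R f P = zeval R f (P - Q) \<oplus> zeval R f Q" by (simp flip: zeval_add)
  then show ?thesis by (simp add: minus_eq a_assoc r_neg)
qed

lemma zeval_frag_of: "zeval R f (frag_of m) = zmon R f m"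
  using add.int_pow_1[of "zmon R f m"] by (simp add: zeval_def)

lemma zeval_one: "zeval R f 1 = \<one>"
  using zeval_frag_of[of 0] by (simp add: zmon_def)

lemma zeval_zvar: "zeval R f (zvar v) = f v"
  by (simp add: zvar_def zeval_frag_of zmon_def f)

lemma zeval_mult: "zeval R f (P * Q) = zeval R f P \<otimes> zeval R f Q"
proof (induction P rule: frag_induction[OF subset_UNIV])
  case (2 m)
  show ?case
  proof (induction Q rule: frag_induction[OF subset_UNIV])
    case (2 m')
    show ?case by (simp add: mult_single zeval_frag_of zmon_add)
  next
    case (3 Q Q')
    then show ?case
      unfolding right_diff_distrib zeval_diff by (simp add: minus_eq r_distr r_minus)
  qed (simp add: zeval_zero)
next
  case (3 P P')
  then show ?case
    unfolding left_diff_distrib zeval_diff by (simp add: minus_eq l_distr l_minus)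
qed (simp add: zeval_zero)

lemma zeval_power: "zeval R f (P ^ k) = zeval R f P [^] k"
  by (induction k) (simp_all add: zeval_one zeval_mult m_comm)

lemma zeval_of_nat_mult: "zeval R f (of_nat k * P) = add_pow R k (zeval R f P)"
  by (induction k) (simp_all add: zeval_zero zeval_add distrib_right a_comm)

end

lemma zeval_cong:
  assumes g: "\<And>v. g v \<in> carrier R"
    and eq: "\<And>m v. m \<in> Poly_Mapping.keys P \<Longrightarrow> v \<in> Poly_Mapping.keys m \<Longrightarrow> f v = g v"
  shows "zeval R f P = zeval R g P"
  unfolding zeval_def
proof (rule finsum_cong')
  fix m assume "m \<in> Poly_Mapping.keys P"
  then have "zmon R f m = zmon R g m"
    unfolding zmon_def using g eq by (intro finprod_cong') auto
  then show "add_pow R (Poly_Mapping.lookup P m) (zmon R f m) =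
      add_pow R (Poly_Mapping.lookup P m) (zmon R g m)" by simp
qed (use g in auto)

lemma zeval_unique:
  assumes f: "\<And>v. f v \<in> carrier R"
    and hom: "h 1 = \<one>" "\<And>P Q. h (P - Q) = h P \<ominus> h Q" "\<And>P Q. h (P * Q) = h P \<otimes> h Q"
    and var: "\<And>v. h (zvar v) = f v"
  shows "h P = zeval R f P"
  by (induction P rule: zpoly_induct)
    (simp_all add: hom var f zeval_one zeval_diff zeval_mult zeval_zvar)

end

interpretation zeval_hom: comm_ring_hom "zeval cring_class_ops f" for f :: "'v \<Rightarrow> 'r::comm_ring_1"
  by unfold_locales
    (simp_all add: carrier_class cring_class.zeval_add cring_class.zeval_mult cring_class.zeval_one)

lemma zeval_class_zvar: "zeval cring_class_ops f (zvar v) = f v"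
  by (simp add: carrier_class cring_class.zeval_zvar)

subsection \<open>The Witt polynomials\<close>

definition zpoly_frobenius :: "nat \<Rightarrow> 'v zpoly \<Rightarrow> 'v zpoly" where
  "zpoly_frobenius p = zeval cring_class_ops (\<lambda>v. zvar v ^ p)"

lemma frobenius_lift_zpoly_frobenius:
  assumes p: "Factorial_Ring.prime p"
  shows "frobenius_lift (zpoly_frobenius p :: 'v zpoly \<Rightarrow> 'v zpoly) p"
proof -
  interpret comm_ring_hom "zpoly_frobenius p :: 'v zpoly \<Rightarrow> 'v zpoly"
    unfolding zpoly_frobenius_def by (rule zeval_hom.comm_ring_hom_axioms)
  show ?thesis
  proof
    fix P :: "'v zpoly"
    show "of_nat p dvd zpoly_frobenius p P - P ^ p"
    proof (induction P rule: zpoly_induct)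
      case (var v)
      show ?case by (simp add: zpoly_frobenius_def zeval_class_zvar)
    next
      case (diff P Q)
      have "of_nat p dvd (zpoly_frobenius p P - P ^ p) - (zpoly_frobenius p Q - Q ^ p)
          + (P ^ p - ((P - Q) ^ p + Q ^ p))"
        using prime_dvd_power_add_diff[OF p, of "P - Q" Q]
        by (intro dvd_add[OF dvd_diff[OF diff]]) simp
      then show ?case by (simp add: hom_diff algebra_simps)
    next
      case (mult P Q)
      have "of_nat p dvd (zpoly_frobenius p P - P ^ p) * zpoly_frobenius p Q
          + P ^ p * (zpoly_frobenius p Q - Q ^ p)"
        using mult by (intro dvd_add dvd_mult dvd_mult2)
      then show ?case by (simp add: hom_mult power_mult_distrib algebra_simps)
    qed (simp add: hom_one)
  qed
qed

lemma witt_var_eq_zvar: "witt_var v = zvar v"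
  by (simp add: witt_var_def zvar_def)

lemma ghost_eq_ghost_component: "ghost p S n = ghost_component p S n"
  by (simp add: ghost_def ghost_component_def)

context
  fixes p :: nat
  assumes p: "Factorial_Ring.prime p"
begin

interpretation frobenius_lift "zpoly_frobenius p :: witt_poly \<Rightarrow> witt_poly" p
  by (rule frobenius_lift_zpoly_frobenius[OF p])

lemma ghost_the_witt_poly:
  assumes "dwork_sequence t"
  shows "ghost p (THE S. \<forall>n. ghost p S n = t n) n = t n"
proof -
  have "\<exists>!S. ghost_component p S = t"
  proof (rule ex1I)
    show inverse: "ghost_component p (ghost_inverse p t) = t"
      by (rule ext) (rule ghost_component_ghost_inverse[OF assms])
    fix S assume "ghost_component p S = t"
    with inverse have "ghost_component p S = ghost_component p (ghost_inverse p t)" by simp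
    then show "S = ghost_inverse p t"
      by (rule ghost_component_inj[OF zpoly_torsion_free[OF prime_gt_0_nat[OF p]], rotated])
  qed
  from theI'[OF this] show ?thesis by (simp add: ghost_eq_ghost_component fun_eq_iff)
qed

lemma ghost_witt_add_poly:
  "ghost p (witt_add_poly p) n =
    ghost p (\<lambda>i. witt_var (Inl i)) n + ghost p (\<lambda>i. witt_var (Inr i)) n"
  unfolding witt_add_poly_def ghost_eq_ghost_component[of _ "\<lambda>i. witt_var (f i)" for f]
  by (intro ghost_the_witt_poly dwork_sequence_add dwork_sequence_ghost_component)

lemma ghost_witt_mult_poly:
  "ghost p (witt_mult_poly p) n =
    ghost p (\<lambda>i. witt_var (Inl i)) n * ghost p (\<lambda>i. witt_var (Inr i)) n"
  unfolding witt_mult_poly_def ghost_eq_ghost_component[of _ "\<lambda>i. witt_var (f i)" for f]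
  by (intro ghost_the_witt_poly dwork_sequence_mult dwork_sequence_ghost_component)

end

subsection \<open>Witt vectors over a ring of characteristic \<open>p\<close>\<close>

locale char_p_ring = cring B for B :: "('a, 'm) ring_scheme" (structure) +
  fixes p :: nat
  assumes p_prime: "Factorial_Ring.prime p"
    and char_p: "add_pow B p \<one> = \<zero>"
begin

abbreviation W :: "(nat \<Rightarrow> 'a) ring" where "W \<equiv> witt_ring p B"

definition reduction :: "'a zpoly \<Rightarrow> 'a" where
  "reduction = zeval B (\<lambda>v. if v \<in> carrier B then v else \<zero>)"

text \<open>The choice \<open>lift \<zero> = 0\<close> makes lifts of Witt vectors with disjoint supports add up
  componentwise.\<close>

definition lift :: "'a \<Rightarrow> 'a zpoly" where
  "lift x = (if x = \<zero> then 0 else zvar x)"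

lemma p_pos [simp]: "0 < p" "p \<noteq> 0"
  using prime_gt_0_nat[OF p_prime] by simp_all

lemma le_prime_power: "k \<le> p ^ k"
  using prime_gt_1_nat[OF p_prime] by (intro less_imp_le power_gt_expt) simp

lemma zero_pow_p_power [simp]: "\<zero> [^] (p ^ k) = \<zero>"
  by (simp add: nat_pow_zero)

lemma reduction_hom:
  "reduction P \<in> carrier B" "reduction (P + Q) = reduction P \<oplus> reduction Q"
  "reduction (P * Q) = reduction P \<otimes> reduction Q" "reduction 1 = \<one>" "reduction 0 = \<zero>"
  "reduction (P ^ k) = reduction P [^] k" "reduction (P - Q) = reduction P \<ominus> reduction Q"
  unfolding reduction_def
  by (simp_all add: zeval_add zeval_mult zeval_one zeval_zero zeval_power zeval_diff)

lemma reduction_of_nat_mult: "reduction (of_nat k * P) = add_pow B k (reduction P)"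
  by (simp add: reduction_def zeval_of_nat_mult)

lemma reduction_lift: "x \<in> carrier B \<Longrightarrow> reduction (lift x) = x"
  by (simp add: lift_def reduction_def zeval_zvar zeval_zero)

lemma add_pow_p: "x \<in> carrier B \<Longrightarrow> add_pow B p x = \<zero>"
  using add_pow_ldistr[of \<one> x p] char_p by simp

lemma reduction_cong:
  assumes "of_nat p dvd P - Q"
  shows "reduction P = reduction Q"
proof -
  obtain D where "P - Q = of_nat p * D" using assms by (elim dvdE)
  then have "reduction P \<ominus> reduction Q = add_pow B p (reduction D)"
    by (simp only: reduction_of_nat_mult flip: reduction_hom(7))
  then have "reduction P \<ominus> reduction Q = \<zero>" by (simp add: add_pow_p reduction_hom)
  then show ?thesis by (simp add: reduction_hom)
qed

lemma frobenius_add: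
  assumes "x \<in> carrier B" "y \<in> carrier B"
  shows "(x \<oplus> y) [^] p = x [^] p \<oplus> y [^] p"
  using reduction_cong[OF prime_dvd_power_add_diff[OF p_prime, of "lift x" "lift y"]] assms
  by (simp add: reduction_hom reduction_lift)

lemma frobenius_ring_hom: "ring_hom_ring B B (\<lambda>x. x [^] p)"
  by (intro ring_hom_ringI ring_axioms) (simp_all add: frobenius_add nat_pow_distrib)

lemma frobenius_diff:
  assumes "x \<in> carrier B" "y \<in> carrier B"
  shows "(x \<ominus> y) [^] p = x [^] p \<ominus> y [^] p"
proof -
  interpret frobenius: ring_hom_ring B B "\<lambda>x. x [^] p" by (rule frobenius_ring_hom)
  show ?thesis using assms by (simp add: minus_eq)
qed

lemma frobenius_power_add:
  assumes "x \<in> carrier B" "y \<in> carrier B"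
  shows "(x \<oplus> y) [^] (p ^ k) = x [^] (p ^ k) \<oplus> y [^] (p ^ k)"
proof (induction k)
  case (Suc k)
  have "z [^] (p ^ Suc k) = (z [^] (p ^ k)) [^] p" if "z \<in> carrier B" for z
    using that by (simp add: nat_pow_pow mult.commute)
  then show ?case using assms by (simp only: a_closed Suc frobenius_add nat_pow_closed)
qed (use assms in simp)

text \<open>\<open>g\<close> is the sequence of ghost components of some lift of \<open>a\<close> to Witt vectors over
  \<open>\<int>[X\<^sub>b | b \<in> B]\<close>.\<close>

definition has_ghost :: "(nat \<Rightarrow> 'a) \<Rightarrow> (nat \<Rightarrow> 'a zpoly) \<Rightarrow> bool" where
  "has_ghost a g \<longleftrightarrow> (\<exists>U. a = (\<lambda>n. reduction (U n)) \<and> g = ghost_component p U)"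

lemma has_ghostI: "(\<And>n. a n = reduction (U n)) \<Longrightarrow> (\<And>n. g n = ghost_component p U n) \<Longrightarrow> has_ghost a g"
  unfolding has_ghost_def by blast

lemma has_ghost_cong_unique:
  assumes "has_ghost a g" "has_ghost b h" "\<And>n. of_nat p ^ Suc n dvd g n - h n"
  shows "a = b"
proof
  fix n
  obtain U V where U: "a = (\<lambda>n. reduction (U n))" "g = ghost_component p U"
    and V: "b = (\<lambda>n. reduction (V n))" "h = ghost_component p V"
    using assms(1,2) unfolding has_ghost_def by blast
  have "of_nat p dvd U n - V n"
    using assms(3) unfolding U(2) V(2)
    by (rule components_dvd_diff_if_ghost_components[OF zpoly_torsion_free[OF p_pos(1)], rotated])
  then show "a n = b n" by (simp add: U V reduction_cong)
qed

lemma has_ghost_unique: "has_ghost a g \<Longrightarrow> has_ghost b h \<Longrightarrow> (\<And>n. g n = h n) \<Longrightarrow> a = b"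
  by (erule (1) has_ghost_cong_unique) simp

lemma witt_ring_simps:
  "carrier W = {a. \<forall>n. a n \<in> carrier B}" "\<one>\<^bsub>W\<^esub> = teichmuller B \<one>" "\<zero>\<^bsub>W\<^esub> = (\<lambda>_. \<zero>)"
  by (simp_all add: witt_ring_def)

lemma component_closed [intro]: "a \<in> carrier W \<Longrightarrow> a n \<in> carrier B"
  by (simp add: witt_ring_simps)

lemma eval_witt_poly_reduction:
  "eval_witt_poly B (case_sum (\<lambda>n. reduction (U n)) (\<lambda>n. reduction (V n))) P =
   reduction (zeval cring_class_ops (case_sum U V) P)"
  unfolding eval_witt_poly_eq_zeval
  by (rule zeval_unique[symmetric, of _ "\<lambda>P. reduction (zeval cring_class_ops (case_sum U V) P)"])
    (auto simp: zeval_hom.hom_diff zeval_hom.hom_mult zeval_hom.hom_one zeval_class_zvar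
      reduction_hom split: sum.splits)

lemma has_ghost_witt_poly:
  assumes "has_ghost a g" "has_ghost b h"
    and ghost: "\<And>n. ghost p S n =
      F (ghost p (\<lambda>i. witt_var (Inl i)) n) (ghost p (\<lambda>i. witt_var (Inr i)) n)"
    and zeval: "\<And>f P Q. zeval cring_class_ops f (F P Q) =
      F' (zeval cring_class_ops f P) (zeval cring_class_ops f Q)"
  shows "has_ghost (\<lambda>n. eval_witt_poly B (case_sum a b) (S n)) (\<lambda>n. F' (g n) (h n))"
proof -
  obtain U V where U: "a = (\<lambda>n. reduction (U n))" "g = ghost_component p U"
    and V: "b = (\<lambda>n. reduction (V n))" "h = ghost_component p V"
    using assms(1,2) unfolding has_ghost_def by blast
  let ?e = "zeval cring_class_ops (case_sum U V)"
  have "?e (ghost p (\<lambda>i. witt_var (v i)) n) = ghost_component p (\<lambda>i. case_sum U V (v i)) n" for v n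
    by (simp add: ghost_eq_ghost_component zeval_hom.hom_ghost_component witt_var_eq_zvar
        zeval_class_zvar)
  then have "ghost_component p (\<lambda>n. ?e (S n)) n = F' (g n) (h n)" for n
    unfolding zeval_hom.hom_ghost_component[symmetric] ghost_eq_ghost_component[symmetric]
      ghost zeval
    by (simp add: U V)
  then show ?thesis
    by (intro has_ghostI[of _ "\<lambda>n. ?e (S n)"]) (simp_all add: U V eval_witt_poly_reduction)
qed

lemma has_ghost_add:
  assumes "has_ghost a g" "has_ghost b h"
  shows "has_ghost (a \<oplus>\<^bsub>W\<^esub> b) (\<lambda>n. g n + h n)"
  using has_ghost_witt_poly[OF assms ghost_witt_add_poly[OF p_prime] zeval_hom.hom_add]
  by (simp add: witt_ring_def)

lemma has_ghost_mult:
  assumes "has_ghost a g" "has_ghost b h"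
  shows "has_ghost (a \<otimes>\<^bsub>W\<^esub> b) (\<lambda>n. g n * h n)"
  using has_ghost_witt_poly[OF assms ghost_witt_mult_poly[OF p_prime] zeval_hom.hom_mult]
  by (simp add: witt_ring_def)

lemma has_ghost_lift:
  assumes "a \<in> carrier W"
  shows "has_ghost a (ghost_component p (\<lambda>n. lift (a n)))"
  using assms by (intro has_ghostI) (auto simp: reduction_lift witt_ring_simps(1))

lemma has_ghost_zero: "has_ghost \<zero>\<^bsub>W\<^esub> (\<lambda>_. 0)"
  by (rule has_ghostI[of _ "\<lambda>_. 0"])
    (simp_all add: witt_ring_simps reduction_hom ghost_component_def power_0_left)

lemma ghost_component_concentrated:
  "ghost_component p (\<lambda>n. if n = 0 then x else 0) n = x ^ (p ^ n)"
proof -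
  have "ghost_component p (\<lambda>n. if n = 0 then x else 0) n = (\<Sum>i\<le>n. if i = 0 then x ^ (p ^ n) else 0)"
    unfolding ghost_component_def by (intro sum.cong) (auto simp: power_0_left)
  then show ?thesis by simp
qed

lemma has_ghost_teichmuller:
  "x \<in> carrier B \<Longrightarrow> has_ghost (teichmuller B x) (\<lambda>n. lift x ^ (p ^ n))"
  by (rule has_ghostI[of _ "\<lambda>n. if n = 0 then lift x else 0"])
    (simp_all add: teichmuller_def reduction_hom reduction_lift ghost_component_concentrated)

lemma has_ghost_one: "has_ghost \<one>\<^bsub>W\<^esub> (\<lambda>_. 1)"
  by (rule has_ghostI[of _ "\<lambda>n. if n = 0 then 1 else 0"])
    (simp_all add: witt_ring_simps teichmuller_def reduction_hom ghost_component_concentrated)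

lemma has_ghost_closed: "has_ghost a g \<Longrightarrow> a \<in> carrier W"
  by (auto simp: has_ghost_def witt_ring_simps reduction_hom)

lemma has_ghost_exists:
  assumes "a \<in> carrier W"
  obtains g where "has_ghost a g"
  using has_ghost_lift[OF assms] by blast

lemma witt_neg_exists:
  assumes "a \<in> carrier W"
  shows "\<exists>b\<in>carrier W. b \<oplus>\<^bsub>W\<^esub> a = \<zero>\<^bsub>W\<^esub>"
proof -
  interpret frobenius_lift "zpoly_frobenius p :: 'a zpoly \<Rightarrow> 'a zpoly" p
    by (rule frobenius_lift_zpoly_frobenius[OF p_prime])
  let ?g = "ghost_component p (\<lambda>n. lift (a n))"
  let ?S = "ghost_inverse p (\<lambda>n. - ?g n)"
  have neg: "has_ghost (\<lambda>n. reduction (?S n)) (\<lambda>n. - ?g n)"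
    by (intro has_ghostI[of _ ?S] refl sym[OF ghost_component_ghost_inverse]
        dwork_sequence_uminus dwork_sequence_ghost_component)
  have "(\<lambda>n. reduction (?S n)) \<oplus>\<^bsub>W\<^esub> a = \<zero>\<^bsub>W\<^esub>"
    by (rule has_ghost_unique[OF has_ghost_add[OF neg has_ghost_lift[OF assms]] has_ghost_zero])
      simp
  then show ?thesis using has_ghost_closed[OF neg] by blast
qed

lemma abelian_group_witt_ring: "abelian_group W"
proof (rule abelian_groupI)
  fix a b assume "a \<in> carrier W" "b \<in> carrier W"
  then obtain g h where ghost_a: "has_ghost a g" and ghost_b: "has_ghost b h"
    by (metis has_ghost_exists)
  show "a \<oplus>\<^bsub>W\<^esub> b \<in> carrier W" by (rule has_ghost_closed[OF has_ghost_add[OF ghost_a ghost_b]])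
  show "a \<oplus>\<^bsub>W\<^esub> b = b \<oplus>\<^bsub>W\<^esub> a"
    by (rule has_ghost_unique[OF has_ghost_add[OF ghost_a ghost_b]
          has_ghost_add[OF ghost_b ghost_a] add.commute])
  fix c assume "c \<in> carrier W"
  then obtain k where ghost_c: "has_ghost c k" by (metis has_ghost_exists)
  show "a \<oplus>\<^bsub>W\<^esub> b \<oplus>\<^bsub>W\<^esub> c = a \<oplus>\<^bsub>W\<^esub> (b \<oplus>\<^bsub>W\<^esub> c)"
    by (rule has_ghost_unique[OF has_ghost_add[OF has_ghost_add[OF ghost_a ghost_b] ghost_c]
          has_ghost_add[OF ghost_a has_ghost_add[OF ghost_b ghost_c]] add.assoc])
next
  show "\<zero>\<^bsub>W\<^esub> \<in> carrier W" by (rule has_ghost_closed[OF has_ghost_zero])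
  fix a assume "a \<in> carrier W"
  then obtain g where ghost_a: "has_ghost a g" by (rule has_ghost_exists)
  show "\<zero>\<^bsub>W\<^esub> \<oplus>\<^bsub>W\<^esub> a = a"
    by (rule has_ghost_unique[OF has_ghost_add[OF has_ghost_zero ghost_a] ghost_a add_0])
qed (rule witt_neg_exists)

lemma comm_monoid_witt_ring: "Group.comm_monoid W"
proof (rule comm_monoidI)
  fix a b assume "a \<in> carrier W" "b \<in> carrier W"
  then obtain g h where ghost_a: "has_ghost a g" and ghost_b: "has_ghost b h"
    by (metis has_ghost_exists)
  show "a \<otimes>\<^bsub>W\<^esub> b \<in> carrier W" by (rule has_ghost_closed[OF has_ghost_mult[OF ghost_a ghost_b]])
  show "a \<otimes>\<^bsub>W\<^esub> b = b \<otimes>\<^bsub>W\<^esub> a"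
    by (rule has_ghost_unique[OF has_ghost_mult[OF ghost_a ghost_b]
          has_ghost_mult[OF ghost_b ghost_a] mult.commute])
  fix c assume "c \<in> carrier W"
  then obtain k where ghost_c: "has_ghost c k" by (metis has_ghost_exists)
  show "a \<otimes>\<^bsub>W\<^esub> b \<otimes>\<^bsub>W\<^esub> c = a \<otimes>\<^bsub>W\<^esub> (b \<otimes>\<^bsub>W\<^esub> c)"
    by (rule has_ghost_unique[OF has_ghost_mult[OF has_ghost_mult[OF ghost_a ghost_b] ghost_c]
          has_ghost_mult[OF ghost_a has_ghost_mult[OF ghost_b ghost_c]] mult.assoc])
next
  show "\<one>\<^bsub>W\<^esub> \<in> carrier W" by (rule has_ghost_closed[OF has_ghost_one])
  fix a assume "a \<in> carrier W"
  then obtain g where ghost_a: "has_ghost a g" by (rule has_ghost_exists)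
  show "\<one>\<^bsub>W\<^esub> \<otimes>\<^bsub>W\<^esub> a = a"
    by (rule has_ghost_unique[OF has_ghost_mult[OF has_ghost_one ghost_a] ghost_a mult_1])
qed

lemma cring_witt_ring: "cring W"
proof (rule cringI[OF abelian_group_witt_ring comm_monoid_witt_ring])
  fix a b c assume "a \<in> carrier W" "b \<in> carrier W" "c \<in> carrier W"
  then obtain g h k
    where ghost_a: "has_ghost a g" and ghost_b: "has_ghost b h" and ghost_c: "has_ghost c k"
    by (metis has_ghost_exists)
  show "(a \<oplus>\<^bsub>W\<^esub> b) \<otimes>\<^bsub>W\<^esub> c = a \<otimes>\<^bsub>W\<^esub> c \<oplus>\<^bsub>W\<^esub> b \<otimes>\<^bsub>W\<^esub> c"
    by (rule has_ghost_unique[OF has_ghost_mult[OF has_ghost_add[OF ghost_a ghost_b] ghost_c]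
          has_ghost_add[OF has_ghost_mult[OF ghost_a ghost_c] has_ghost_mult[OF ghost_b ghost_c]]
          distrib_right])
qed

sublocale W: cring W by (rule cring_witt_ring)

lemma teichmuller_closed [simp]: "x \<in> carrier B \<Longrightarrow> teichmuller B x \<in> carrier W"
  by (simp add: witt_ring_simps teichmuller_def)

lemma teichmuller_component_0 [simp]: "teichmuller B x 0 = x"
  by (simp add: teichmuller_def)

lemma teichmuller_zero: "teichmuller B \<zero> = \<zero>\<^bsub>W\<^esub>"
  by (simp add: teichmuller_def witt_ring_simps fun_eq_iff)

lemma has_ghost_component_0: "has_ghost a g \<Longrightarrow> a 0 = reduction (g 0)"
  by (auto simp: has_ghost_def ghost_component_def)

lemma component_0_ring_hom: "ring_hom_ring W B (\<lambda>a. a 0)"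
proof (rule ring_hom_ringI[OF W.ring_axioms ring_axioms])
  show "\<one>\<^bsub>W\<^esub> 0 = \<one>" by (simp add: witt_ring_simps teichmuller_def)
  fix a b assume "a \<in> carrier W" "b \<in> carrier W"
  then obtain g h where ghost_a: "has_ghost a g" and ghost_b: "has_ghost b h"
    by (metis has_ghost_exists)
  note components = has_ghost_component_0[OF ghost_a] has_ghost_component_0[OF ghost_b]
  show "(a \<oplus>\<^bsub>W\<^esub> b) 0 = a 0 \<oplus> b 0"
    using has_ghost_component_0[OF has_ghost_add[OF ghost_a ghost_b]]
    by (simp add: components reduction_hom)
  show "(a \<otimes>\<^bsub>W\<^esub> b) 0 = a 0 \<otimes> b 0"
    using has_ghost_component_0[OF has_ghost_mult[OF ghost_a ghost_b]]
    by (simp add: components reduction_hom)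
qed (rule component_closed)

lemma witt_add_disjoint:
  assumes a: "a \<in> carrier W" and b: "b \<in> carrier W" and disj: "\<And>n. a n = \<zero> \<or> b n = \<zero>"
  shows "a \<oplus>\<^bsub>W\<^esub> b = (\<lambda>n. a n \<oplus> b n)"
proof (rule has_ghost_unique[OF has_ghost_add[OF has_ghost_lift[OF a] has_ghost_lift[OF b]]])
  let ?U = "\<lambda>n. lift (a n) + lift (b n)"
  show "has_ghost (\<lambda>n. a n \<oplus> b n) (ghost_component p ?U)"
    using a b by (intro has_ghostI) (auto simp: reduction_hom reduction_lift witt_ring_simps(1))
  have "lift (a i) ^ p ^ (n - i) + lift (b i) ^ p ^ (n - i) = ?U i ^ p ^ (n - i)" for i n
    using disj[of i] by (auto simp: lift_def power_0_left)
  then show "ghost_component p (\<lambda>n. lift (a n)) n + ghost_component p (\<lambda>n. lift (b n)) n =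
      ghost_component p ?U n" for n
    unfolding ghost_component_def sum.distrib[symmetric] distrib_left[symmetric] by simp
qed

lemma teichmuller_mult_witt:
  assumes x: "x \<in> carrier B" and w: "w \<in> carrier W"
  shows "teichmuller B x \<otimes>\<^bsub>W\<^esub> w = (\<lambda>n. x [^] (p ^ n) \<otimes> w n)"
proof (rule has_ghost_unique[OF has_ghost_mult[OF has_ghost_teichmuller[OF x] has_ghost_lift[OF w]]])
  let ?U = "\<lambda>n. lift x ^ (p ^ n) * lift (w n)"
  show "has_ghost (\<lambda>n. x [^] (p ^ n) \<otimes> w n) (ghost_component p ?U)"
    using assms by (intro has_ghostI) (auto simp: reduction_hom reduction_lift witt_ring_simps(1))
  show "lift x ^ p ^ n * ghost_component p (\<lambda>n. lift (w n)) n = ghost_component p ?U n" for n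
    unfolding ghost_component_def sum_distrib_left
    by (intro sum.cong) (auto simp: power_mult_distrib algebra_simps simp flip: power_mult power_add)
qed

lemma teichmuller_mult:
  assumes "x \<in> carrier B" "y \<in> carrier B"
  shows "teichmuller B (x \<otimes> y) = teichmuller B x \<otimes>\<^bsub>W\<^esub> teichmuller B y"
  unfolding teichmuller_mult_witt[OF assms(1) teichmuller_closed[OF assms(2)]]
  using assms by (simp add: teichmuller_def fun_eq_iff)

lemma teichmuller_pow:
  "x \<in> carrier B \<Longrightarrow> teichmuller B (x [^] (k::nat)) = teichmuller B x [^]\<^bsub>W\<^esub> k"
  by (induction k) (simp_all add: teichmuller_mult flip: witt_ring_simps(2))

lemma has_ghost_add_pow:
  assumes "has_ghost a g"
  shows "has_ghost (add_pow W (k::nat) a) (\<lambda>n. of_nat k * g n)"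
proof (induction k)
  case 0
  show ?case using has_ghost_zero by simp
next
  case (Suc k)
  then show ?case using has_ghost_add[OF Suc assms] by (simp add: algebra_simps)
qed

lemma ghost_component_shift_frobenius:
  "ghost_component p (case_nat 0 (\<lambda>k. a k ^ p)) n = of_nat p * lower_ghost_sum p a n"
proof (cases n)
  case (Suc k)
  show ?thesis
    unfolding Suc lower_ghost_sum_Suc ghost_component_def sum_distrib_left
    by (subst sum.atMost_Suc_shift) (simp add: power_0_left mult.assoc)
qed (simp add: ghost_component_def lower_ghost_sum_def)

lemma add_pow_p_witt:
  assumes w: "w \<in> carrier W"
  shows "add_pow W p w = case_nat \<zero> (\<lambda>k. w k [^] p)"
proof (rule has_ghost_cong_unique[OF has_ghost_add_pow[OF has_ghost_lift[OF w]]])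
  let ?U = "case_nat 0 (\<lambda>k. lift (w k) ^ p)"
  show "has_ghost (case_nat \<zero> (\<lambda>k. w k [^] p)) (ghost_component p ?U)"
    using w
    by (intro has_ghostI)
      (auto simp: reduction_hom reduction_lift witt_ring_simps(1) split: nat.splits)
  show "of_nat p ^ Suc n dvd
      of_nat p * ghost_component p (\<lambda>n. lift (w n)) n - ghost_component p ?U n" for n
    unfolding ghost_component_shift_frobenius ghost_component_eq[of p "\<lambda>n. lift (w n)"]
    by (simp add: distrib_left flip: mult.assoc)
qed

end

subsection \<open>Powers of ideals and adic topologies\<close>

lemma (in abelian_group) minus_add_cancel:
  "x \<in> carrier G \<Longrightarrow> y \<in> carrier G \<Longrightarrow> (x \<ominus> y) \<oplus> y = x"
  by (simp add: minus_eq a_assoc l_neg)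

context cring begin

abbreviation ideal_power :: "'a set \<Rightarrow> nat \<Rightarrow> 'a set" where
  "ideal_power I n \<equiv> I [^]\<^bsub>ideals_set R\<^esub> n"

lemma ideal_power_0: "ideal_power I 0 = carrier R"
  by (simp add: ideals_set_def)

lemma ideal_power_Suc: "ideal_power I (Suc n) = ideal_prod R (ideal_power I n) I"
  by (simp add: ideals_set_def)

lemma ideal_prod_mono:
  assumes "I \<subseteq> I'" "J \<subseteq> J'"
  shows "ideal_prod R I J \<subseteq> ideal_prod R I' J'"
proof
  fix x assume "x \<in> ideal_prod R I J"
  then show "x \<in> ideal_prod R I' J'"
    by (induction rule: ideal_prod.induct) (use assms in \<open>auto intro: ideal_prod.intros\<close>)
qed

lemma ideal_power_mono: "I \<subseteq> J \<Longrightarrow> ideal_power I n \<subseteq> ideal_power J n"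
  by (induction n) (simp_all only: ideal_power_0 ideal_power_Suc ideal_prod_mono order_refl)

lemma ideal_minus_closed: "ideal I R \<Longrightarrow> a \<in> I \<Longrightarrow> b \<in> I \<Longrightarrow> a \<ominus> b \<in> I"
  by (simp add: minus_eq additive_subgroup.a_closed additive_subgroup.a_inv_closed ideal.axioms(1))

lemma ideal_plus_closed: "ideal I R \<Longrightarrow> a \<in> I \<Longrightarrow> b \<in> I \<Longrightarrow> a \<oplus> b \<in> I"
  by (simp add: additive_subgroup.a_closed ideal.axioms(1))

lemma ideal_zero_mem: "ideal I R \<Longrightarrow> \<zero> \<in> I"
  by (simp add: additive_subgroup.zero_closed ideal.axioms(1))

lemma ideal_finsum_closed:
  assumes "ideal I R" "\<And>x. x \<in> A \<Longrightarrow> f x \<in> I"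
  shows "finsum R f A \<in> I"
  using assms(2)
proof (induction A rule: infinite_finite_induct)
  case (insert x A)
  then have "f \<in> insert x A \<rightarrow> carrier R" using ideal.Icarr[OF assms(1)] by blast
  then show ?case using insert by (simp add: Pi_iff ideal_plus_closed[OF assms(1)])
qed (simp_all add: ideal_zero_mem[OF assms(1)])

lemma ideal_prod_genideal_singleton:
  assumes I: "ideal I R" and a: "a \<in> carrier R"
  shows "ideal_prod R I (Idl {a}) = (\<lambda>i. i \<otimes> a) ` I"
proof (intro equalityI subsetI)
  fix x assume "x \<in> ideal_prod R I (Idl {a})"
  then show "x \<in> (\<lambda>i. i \<otimes> a) ` I"
  proof (induction rule: ideal_prod.induct)
    case (prod i j)
    then obtain r where "r \<in> carrier R" "j = r \<otimes> a"
      unfolding cgenideal_eq_genideal[OF a, symmetric] cgenideal_def by blast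
    moreover have "i \<in> carrier R" using I prod(1) by (rule ideal.Icarr)
    ultimately have "i \<otimes> j = (i \<otimes> r) \<otimes> a" "i \<otimes> r \<in> I"
      using a prod(1) by (simp_all add: m_assoc ideal.I_r_closed[OF I])
    then show ?case by (rule image_eqI)
  next
    case (sum x y)
    then obtain i j where summands: "i \<in> I" "j \<in> I" "x = i \<otimes> a" "y = j \<otimes> a" by blast
    then have "x \<oplus> y = (i \<oplus> j) \<otimes> a" using ideal.Icarr[OF I] a by (simp add: l_distr)
    then show ?case using ideal_plus_closed[OF I summands(1,2)] by (rule image_eqI)
  qed
next
  fix x assume "x \<in> (\<lambda>i. i \<otimes> a) ` I"
  then show "x \<in> ideal_prod R I (Idl {a})"
    using genideal_self'[OF a] by (auto intro: ideal_prod.prod)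
qed

context
  fixes I :: "'a set"
  assumes I: "ideal I R"
begin

lemma ideal_ideal_power: "ideal (ideal_power I n) R"
proof -
  interpret ideals: comm_monoid "ideals_set R" by (rule ideals_set_is_comm_monoid)
  show ?thesis using ideals.nat_pow_closed[of I n] I by (simp add: ideals_set_def)
qed

lemma ideal_power_closed: "x \<in> ideal_power I n \<Longrightarrow> x \<in> carrier R"
  by (rule ideal.Icarr[OF ideal_ideal_power])

lemma ideal_power_1: "ideal_power I 1 = I"
proof -
  interpret ideals: comm_monoid "ideals_set R" by (rule ideals_set_is_comm_monoid)
  show ?thesis using ideals.nat_pow_eone[of I] I by (simp add: ideals_set_def)
qed

lemma ideal_power_antimono: "m \<le> n \<Longrightarrow> ideal_power I n \<subseteq> ideal_power I m"
proof (rule lift_Suc_antimono_le[of "ideal_power I"])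
  show "ideal_power I (Suc n) \<subseteq> ideal_power I n" for n
    unfolding ideal_power_Suc using ideal_prod_inter[OF ideal_ideal_power I] by blast
qed

lemma pow_mem_ideal_power: "a \<in> I \<Longrightarrow> a [^] n \<in> ideal_power I n"
proof (induction n)
  case (Suc n)
  then show ?case unfolding ideal_power_Suc by (simp add: ideal_prod.prod)
qed (simp add: ideals_set_def)

lemma mem_l_coset_iff:
  assumes "x \<in> carrier R"
  shows "y \<in> x <+ I \<longleftrightarrow> y \<in> carrier R \<and> y \<ominus> x \<in> I"
proof -
  interpret abelian_subgroup I R
    by (rule abelian_subgroupI3[OF ideal.axioms(1)[OF I] is_abelian_group])
  have "x <+ I \<subseteq> carrier R"
    using assms ideal.Icarr[OF I] by (auto simp: a_l_coset_def')
  then show ?thesis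
    using a_rcos_module_minus[OF ring_axioms assms] a_coset_eq assms by blast
qed

end

lemma istopology_adic:
  assumes I: "ideal I R"
  shows "istopology (\<lambda>U. U \<subseteq> carrier R \<and> (\<forall>x\<in>U. \<exists>n. x <+ ideal_power I n \<subseteq> U))" (is "istopology ?P")
  unfolding istopology_def
proof (intro conjI allI impI)
  fix S T assume S: "?P S" and T: "?P T"
  then show "S \<inter> T \<subseteq> carrier R" by blast
  show "\<forall>x\<in>S \<inter> T. \<exists>n. x <+ ideal_power I n \<subseteq> S \<inter> T"
  proof
    fix x assume "x \<in> S \<inter> T"
    then obtain m n where subsets: "x <+ ideal_power I m \<subseteq> S" "x <+ ideal_power I n \<subseteq> T"
      using S T by (meson IntD1 IntD2)
    have "x <+ ideal_power I (max m n) \<subseteq> x <+ ideal_power I k" if "k \<le> max m n" for k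
      using ideal_power_antimono[OF I that] by (auto simp: a_l_coset_def')
    from this[of m] this[of n] subsets have "x <+ ideal_power I (max m n) \<subseteq> S \<inter> T" by simp blast
    then show "\<exists>n. x <+ ideal_power I n \<subseteq> S \<inter> T" ..
  qed
next
  fix \<K> assume \<K>: "\<forall>S\<in>\<K>. ?P S"
  then show "\<Union>\<K> \<subseteq> carrier R" by blast
  show "\<forall>x\<in>\<Union>\<K>. \<exists>n. x <+ ideal_power I n \<subseteq> \<Union>\<K>"
    using \<K> by (meson UnionE Union_upper subset_trans)
qed

lemma openin_adic_topology:
  assumes I: "ideal I R"
  shows "openin (adic_topology R I) U \<longleftrightarrow>
    U \<subseteq> carrier R \<and> (\<forall>x\<in>U. \<exists>n. \<forall>y\<in>carrier R. y \<ominus> x \<in> ideal_power I n \<longrightarrow> y \<in> U)"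
proof -
  have "openin (adic_topology R I) U \<longleftrightarrow> U \<subseteq> carrier R \<and> (\<forall>x\<in>U. \<exists>n. x <+ ideal_power I n \<subseteq> U)"
    by (simp add: adic_topology_def topology_inverse'[OF istopology_adic[OF I]])
  also have "\<dots> \<longleftrightarrow> U \<subseteq> carrier R \<and> (\<forall>x\<in>U. \<exists>n. \<forall>y\<in>carrier R. y \<ominus> x \<in> ideal_power I n \<longrightarrow> y \<in> U)"
    unfolding subset_iff using mem_l_coset_iff[OF ideal_ideal_power[OF I]]
    by (metis (no_types, lifting))
  finally show ?thesis .
qed

lemma topspace_adic_topology: "ideal I R \<Longrightarrow> topspace (adic_topology R I) = carrier R"
  using openin_adic_topology[of I] by (auto simp: topspace_def)

lemma openin_adic_coset:
  assumes I: "ideal I R" and x: "x \<in> carrier R"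
  shows "openin (adic_topology R I) {y \<in> carrier R. y \<ominus> x \<in> ideal_power I n}"
  unfolding openin_adic_topology[OF I]
proof (intro conjI ballI exI impI)
  fix y z assume y: "y \<in> {y \<in> carrier R. y \<ominus> x \<in> ideal_power I n}"
    and z: "z \<in> carrier R" "z \<ominus> y \<in> ideal_power I n"
  have "z \<ominus> x = (z \<ominus> y) \<oplus> (y \<ominus> x)" using x y z by simp algebra
  then show "z \<in> {y \<in> carrier R. y \<ominus> x \<in> ideal_power I n}"
    using ideal_plus_closed[OF ideal_ideal_power[OF I] z(2), of "y \<ominus> x"] y z by simp
qed auto

lemma limitin_adic_topology_iff:
  assumes I: "ideal I R" and w: "w \<in> carrier R" and s: "\<And>k. s k \<in> carrier R"
  shows "limitin (adic_topology R I) s w F \<longleftrightarrow> (\<forall>n. \<forall>\<^sub>F k in F. s k \<ominus> w \<in> ideal_power I n)"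
proof (intro iffI allI)
  fix n assume "limitin (adic_topology R I) s w F"
  moreover have "w \<in> {y \<in> carrier R. y \<ominus> w \<in> ideal_power I n}"
    using w ideal_zero_mem[OF ideal_ideal_power[OF I]] by (simp add: r_neg minus_eq)
  ultimately have "\<forall>\<^sub>F k in F. s k \<in> {y \<in> carrier R. y \<ominus> w \<in> ideal_power I n}"
    using openin_adic_coset[OF I w] by (simp only: limitin_def)
  then show "\<forall>\<^sub>F k in F. s k \<ominus> w \<in> ideal_power I n" by (rule eventually_mono) simp
next
  assume close: "\<forall>n. \<forall>\<^sub>F k in F. s k \<ominus> w \<in> ideal_power I n"
  show "limitin (adic_topology R I) s w F"
    unfolding limitin_def topspace_adic_topology[OF I]
  proof (intro conjI allI impI)
    fix U assume "openin (adic_topology R I) U \<and> w \<in> U"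
    then obtain n where "\<forall>y\<in>carrier R. y \<ominus> w \<in> ideal_power I n \<longrightarrow> y \<in> U"
      unfolding openin_adic_topology[OF I] by blast
    with close[rule_format, of n] show "\<forall>\<^sub>F k in F. s k \<in> U"
      by (auto elim!: eventually_mono simp: s)
  qed (rule w)
qed

end

lemma (in ring_hom_ring) ideal_image_if_surj:
  assumes I: "ideal I R" and surj: "h ` carrier R = carrier S"
  shows "ideal (h ` I) S"
proof (rule idealI[OF S.ring_axioms])
  show "subgroup (h ` I) (add_monoid S)"
    by (intro img_is_add_subgroup additive_subgroup.a_subgroup ideal.axioms(1) I)
  fix a x assume "a \<in> h ` I" "x \<in> carrier S"
  then obtain i r where i: "i \<in> I" "a = h i" and r: "r \<in> carrier R" "x = h r"
    using surj by blast
  have "i \<in> carrier R" using I i(1) by (rule ideal.Icarr)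
  then have "x \<otimes>\<^bsub>S\<^esub> a = h (r \<otimes> i)" "a \<otimes>\<^bsub>S\<^esub> x = h (i \<otimes> r)" using i r by simp_all
  then show "x \<otimes>\<^bsub>S\<^esub> a \<in> h ` I" "a \<otimes>\<^bsub>S\<^esub> x \<in> h ` I"
    using ideal.I_l_closed[OF I i(1) r(1)] ideal.I_r_closed[OF I i(1) r(1)] by simp_all
qed

subsection \<open>Rings with an ultrametric norm\<close>

locale ultrametric_ring = cring +
  fixes N :: "'a \<Rightarrow> real"
  assumes norm_nonneg: "x \<in> carrier R \<Longrightarrow> 0 \<le> N x"
    and norm_eq_0_iff: "x \<in> carrier R \<Longrightarrow> N x = 0 \<longleftrightarrow> x = \<zero>"
    and norm_diff: "x \<in> carrier R \<Longrightarrow> y \<in> carrier R \<Longrightarrow> N (x \<ominus> y) \<le> max (N x) (N y)"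
    and norm_mult: "x \<in> carrier R \<Longrightarrow> y \<in> carrier R \<Longrightarrow> N (x \<otimes> y) \<le> N x * N y"
begin

lemma norm_zero [simp]: "N \<zero> = 0"
  by (simp add: norm_eq_0_iff)

lemma norm_uminus:
  assumes "x \<in> carrier R"
  shows "N (\<ominus> x) = N x"
proof -
  have "N (\<ominus> y) \<le> N y" if "y \<in> carrier R" for y
    using norm_diff[of \<zero> y] norm_nonneg that by (simp add: minus_eq)
  from this[of x] this[of "\<ominus> x"] show ?thesis using assms by simp
qed

lemma norm_diff_commute:
  assumes "x \<in> carrier R" "y \<in> carrier R"
  shows "N (x \<ominus> y) = N (y \<ominus> x)"
proof -
  have "x \<ominus> y = \<ominus> (y \<ominus> x)" using assms by algebra
  then show ?thesis using assms by (simp add: norm_uminus)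
qed

lemma norm_add:
  assumes "x \<in> carrier R" "y \<in> carrier R"
  shows "N (x \<oplus> y) \<le> max (N x) (N y)"
  using norm_diff[of x "\<ominus> y"] assms by (simp add: minus_eq norm_uminus)

lemma norm_ultrametric:
  assumes "x \<in> carrier R" "y \<in> carrier R" "z \<in> carrier R"
  shows "N (x \<ominus> z) \<le> max (N (x \<ominus> y)) (N (y \<ominus> z))"
proof -
  have "x \<ominus> z = (x \<ominus> y) \<oplus> (y \<ominus> z)" using assms by algebra
  then show ?thesis using norm_add assms by simp
qed

lemma norm_add_pow_nat_le: "x \<in> carrier R \<Longrightarrow> N (add_pow R (k::nat) x) \<le> N x"
proof (induction k)
  case (Suc k)
  then show ?case using norm_add[of "add_pow R k x" x] by simp
qed (simp add: norm_nonneg)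

lemma norm_add_pow_int_le:
  assumes "x \<in> carrier R"
  shows "N (add_pow R (k::int) x) \<le> N x"
  using norm_add_pow_nat_le[OF assms] assms
  by (cases "k \<ge> 0") (simp_all add: add_pow_int_ge add_pow_int_lt norm_uminus)

lemma norm_finsum_le:
  assumes "C \<ge> 0" "\<And>i. i \<in> I \<Longrightarrow> f i \<in> carrier R" "\<And>i. i \<in> I \<Longrightarrow> N (f i) \<le> C"
  shows "N (finsum R f I) \<le> C"
  using assms(2,3)
proof (induction I rule: infinite_finite_induct)
  case (insert i I)
  then have "N (f i \<oplus> finsum R f I) \<le> max (N (f i)) (N (finsum R f I))"
    by (intro norm_add finsum_closed) auto
  also have "\<dots> \<le> C" using insert by simp
  finally show ?case using insert by (simp add: Pi_iff)
qed (simp_all add: assms(1))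

lemma norm_zeval_le:
  fixes f :: "'v \<Rightarrow> 'a"
  assumes f: "\<And>v. f v \<in> carrier R" and "C \<ge> 0"
    and zmon: "\<And>m. m \<in> Poly_Mapping.keys P \<Longrightarrow> N (zmon R f m) \<le> C"
  shows "N (zeval R f P) \<le> C"
  unfolding zeval_def
proof (rule norm_finsum_le)
  fix m assume "m \<in> Poly_Mapping.keys P"
  then show "N (add_pow R (Poly_Mapping.lookup P m) (zmon R f m)) \<le> C"
    by (intro order_trans[OF norm_add_pow_int_le zmon] zmon_closed f)
qed (use assms in simp_all)

sublocale metric: Metric_space "carrier R" "norm_dist R N"
proof
  fix x y z
  show "0 \<le> norm_dist R N x y" by (simp add: norm_dist_def norm_nonneg)
  show "norm_dist R N x y = norm_dist R N y x" by (simp add: norm_dist_def norm_diff_commute)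
  assume x: "x \<in> carrier R" and y: "y \<in> carrier R"
  then show "norm_dist R N x y = 0 \<longleftrightarrow> x = y" by (simp add: norm_dist_def norm_eq_0_iff)
  assume z: "z \<in> carrier R"
  have "N (x \<ominus> z) \<le> max (N (x \<ominus> y)) (N (y \<ominus> z))" by (rule norm_ultrametric[OF x y z])
  also have "\<dots> \<le> N (x \<ominus> y) + N (y \<ominus> z)" using norm_nonneg x y z by simp
  finally show "norm_dist R N x z \<le> norm_dist R N x y + norm_dist R N y z"
    using x y z by (simp add: norm_dist_def)
qed

lemma openin_norm_topology:
  "openin (norm_topology R N) U \<longleftrightarrow>
    U \<subseteq> carrier R \<and> (\<forall>x\<in>U. \<exists>r>0. \<forall>y\<in>carrier R. N (y \<ominus> x) < r \<longrightarrow> y \<in> U)"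
proof -
  have "y \<in> metric.mball x r \<longleftrightarrow> y \<in> carrier R \<and> N (y \<ominus> x) < r" if "x \<in> carrier R" for x y r
    using that by (auto simp: norm_dist_def norm_diff_commute)
  then show ?thesis
    unfolding norm_topology_def metric.openin_mtopology subset_iff by metis
qed

lemma openin_norm_ball: "openin (norm_topology R N) {y \<in> carrier R. N y < r}"
proof -
  have "{y \<in> carrier R. N y < r} = metric.mball \<zero> r"
    by (auto simp: norm_dist_def minus_eq norm_uminus)
  then show ?thesis unfolding norm_topology_def by (simp only: metric.openin_mball)
qed

lemma openin_norm_topology_zero:
  assumes "openin (norm_topology R N) U" "\<zero> \<in> U"
  obtains r where "r > 0" "\<And>y. y \<in> carrier R \<Longrightarrow> N y < r \<Longrightarrow> y \<in> U"
proof -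
  obtain r where "r > 0" "\<forall>y\<in>carrier R. N (y \<ominus> \<zero>) < r \<longrightarrow> y \<in> U"
    using assms unfolding openin_norm_topology by blast
  then show ?thesis by (intro that[of r]) (simp_all add: minus_eq)
qed

lemma ideal_norm_cball:
  assumes norm_le_1: "\<And>x. x \<in> carrier R \<Longrightarrow> N x \<le> 1" and "c \<ge> 0"
  shows "ideal {x \<in> carrier R. N x \<le> c} R" (is "ideal ?C R")
proof (rule idealI[OF ring_axioms])
  show "subgroup ?C (add_monoid R)"
  proof (rule add.subgroupI)
    show "?C \<noteq> {}" using \<open>c \<ge> 0\<close> by (auto intro: exI[of _ \<zero>])
    fix a b assume "a \<in> ?C" "b \<in> ?C"
    then show "\<ominus> a \<in> ?C" "a \<oplus> b \<in> ?C" using norm_add[of a b] by (auto simp: norm_uminus)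
  qed auto
  fix a x assume a: "a \<in> ?C" and x: "x \<in> carrier R"
  have "N (x \<otimes> a) \<le> N x * N a" using norm_mult a x by simp
  also have "\<dots> \<le> 1 * c" using a x \<open>c \<ge> 0\<close> norm_nonneg norm_le_1 by (intro mult_mono) auto
  finally show "x \<otimes> a \<in> ?C" using a x by simp
  then show "a \<otimes> x \<in> ?C" using a x by (simp add: m_comm)
qed

lemma norm_ideal_power_le:
  assumes norm_le_1: "\<And>x. x \<in> carrier R \<Longrightarrow> N x \<le> 1" and "c \<ge> 0"
    and J: "ideal J R" "\<And>x. x \<in> J \<Longrightarrow> N x \<le> c"
    and "x \<in> ideal_power J n"
  shows "N x \<le> c ^ n"
  using assms(5)
proof (induction n arbitrary: x)
  case 0
  then show ?case using norm_le_1 by (simp add: ideals_set_def)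
next
  case (Suc n)
  have "x \<in> ideal_prod R (ideal_power J n) J" using Suc.prems by (simp only: ideal_power_Suc)
  then have "x \<in> {x \<in> carrier R. N x \<le> c ^ Suc n}"
  proof (induction rule: ideal_prod.induct)
    case (prod a b)
    have a: "a \<in> carrier R" "N a \<le> c ^ n"
      using Suc.IH prod(1) ideal_power_closed[OF J(1)] by blast+
    have b: "b \<in> carrier R" "N b \<le> c" using J(2) prod(2) ideal.Icarr[OF J(1)] by blast+
    have "N (a \<otimes> b) \<le> N a * N b" using norm_mult a b by simp
    also have "\<dots> \<le> c ^ n * c" using a b \<open>c \<ge> 0\<close> norm_nonneg by (intro mult_mono) auto
    finally show ?case using a b by (simp add: mult.commute)
  next
    case (sum a b)
    then show ?case using \<open>c \<ge> 0\<close> by (intro ideal_plus_closed ideal_norm_cball norm_le_1) simp_all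
  qed
  then show ?case by simp
qed

lemma norm_topology_eq_adic_topology:
  assumes J: "ideal J R"
    and ball_subset: "\<And>n. \<exists>r>0. \<forall>w\<in>carrier R. N w < r \<longrightarrow> w \<in> ideal_power J n"
    and power_subset: "\<And>r. r > 0 \<Longrightarrow> \<exists>n. \<forall>w\<in>ideal_power J n. N w < r"
  shows "norm_topology R N = adic_topology R J"
proof -
  have "(\<exists>r>0. \<forall>y\<in>carrier R. N (y \<ominus> x) < r \<longrightarrow> y \<in> U) \<longleftrightarrow>
        (\<exists>n. \<forall>y\<in>carrier R. y \<ominus> x \<in> ideal_power J n \<longrightarrow> y \<in> U)" if x: "x \<in> carrier R" for x U
    using ball_subset power_subset minus_closed[OF _ x] by meson
  then show ?thesis
    unfolding topology_eq openin_norm_topology openin_adic_topology[OF J] by blast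
qed

end

locale power_multiplicative_ring = ultrametric_ring +
  assumes norm_pow: "x \<in> carrier R \<Longrightarrow> 0 < k \<Longrightarrow> N (x [^] (k::nat)) = N x ^ k"
begin

lemma norm_one_le: "N \<one> \<le> 1"
proof -
  have "N \<one> ^ 2 = N \<one>" using norm_pow[of \<one> 2] by simp
  then show ?thesis using power_strict_increasing[of 1 2 "N \<one>"] by force
qed

lemma norm_pow_le: "x \<in> carrier R \<Longrightarrow> N (x [^] (k::nat)) \<le> N x ^ k"
  using norm_pow[of x k] norm_one_le by (cases "k = 0") simp_all

lemma norm_le_1_if_powers_bounded:
  assumes x: "x \<in> carrier R" and bound: "\<And>n::nat. N (x [^] n) \<le> C"
  shows "N x \<le> 1"
proof (rule ccontr)
  assume "\<not> N x \<le> 1"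
  then obtain n where "C < N x ^ n" using real_arch_pow[of "N x" C] by auto
  also have "\<dots> \<le> N x ^ Suc n" using \<open>\<not> N x \<le> 1\<close> by (intro power_increasing) simp_all
  also have "\<dots> \<le> C" using bound[of "Suc n"] norm_pow[OF x, of "Suc n"] by (simp only: zero_less_Suc)
  finally show False by simp
qed

lemma norm_finprod_le:
  assumes "\<And>i. i \<in> I \<Longrightarrow> f i \<in> carrier R"
  shows "N (finprod R f I) \<le> (\<Prod>i\<in>I. N (f i))"
  using assms
proof (induction I rule: infinite_finite_induct)
  case (insert i I)
  then have "N (f i \<otimes> finprod R f I) \<le> N (f i) * N (finprod R f I)"
    by (intro norm_mult finprod_closed) auto
  also have "\<dots> \<le> N (f i) * (\<Prod>i\<in>I. N (f i))"
    using insert by (intro mult_left_mono norm_nonneg) auto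
  finally show ?case using insert by (simp add: Pi_iff)
qed (simp_all add: norm_one_le)

end

subsection \<open>Weights of the Witt addition polynomials\<close>

definition zweight :: "('v \<Rightarrow> nat) \<Rightarrow> ('v \<Rightarrow>\<^sub>0 nat) \<Rightarrow> nat" where
  "zweight c m = (\<Sum>v\<in>Poly_Mapping.keys m. c v * Poly_Mapping.lookup m v)"

definition isobaric :: "('v \<Rightarrow> nat) \<Rightarrow> nat \<Rightarrow> 'v zpoly \<Rightarrow> bool" where
  "isobaric c d P \<longleftrightarrow> (\<forall>m\<in>Poly_Mapping.keys P. zweight c m = d)"

lemma zweight_add: "zweight c (m + m') = zweight c m + zweight c m'"
  unfolding zweight_def by (rule setsum_keys_plus_distrib) (auto simp: algebra_simps)

lemma isobaric_add: "isobaric c d P \<Longrightarrow> isobaric c d Q \<Longrightarrow> isobaric c d (P + Q)"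
  using keys_add[of P Q] by (auto simp: isobaric_def)

lemma isobaric_diff: "isobaric c d P \<Longrightarrow> isobaric c d Q \<Longrightarrow> isobaric c d (P - Q)"
  using keys_diff[of P Q] by (auto simp: isobaric_def)

lemma isobaric_sum: "(\<And>i. i \<in> I \<Longrightarrow> isobaric c d (f i)) \<Longrightarrow> isobaric c d (sum f I)"
  using keys_sum[of f I] by (auto simp: isobaric_def)

lemma isobaric_mult:
  assumes "isobaric c d P" "isobaric c e Q"
  shows "isobaric c (d + e) (P * Q)"
  unfolding isobaric_def
proof
  fix m assume "m \<in> Poly_Mapping.keys (P * Q)"
  then obtain a b where "m = a + b" "a \<in> Poly_Mapping.keys P" "b \<in> Poly_Mapping.keys Q"
    using keys_mult[of P Q] by blast
  then show "zweight c m = d + e" using assms by (simp add: zweight_add isobaric_def)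
qed

lemma isobaric_power: "isobaric c d P \<Longrightarrow> isobaric c (d * k) (P ^ k)"
proof (induction k)
  case 0
  show ?case by (simp add: isobaric_def zweight_def)
next
  case (Suc k)
  then show ?case using isobaric_mult[of c d P "d * k" "P ^ k"] by simp
qed

lemma isobaric_of_nat_mult_iff: "0 < k \<Longrightarrow> isobaric c d (of_nat k * P) \<longleftrightarrow> isobaric c d P"
  by (auto simp: isobaric_def of_nat_mult_zpoly)

lemma isobaric_zvar: "isobaric c (c v) (zvar v)"
  by (simp add: isobaric_def zvar_def zweight_def)

lemma isobaric_ghost_summand:
  assumes "0 < p" "isobaric c (p ^ i) P" "i \<le> n"
  shows "isobaric c (p ^ n) (of_nat p ^ i * P ^ (p ^ (n - i)))"
  using isobaric_power[OF assms(2), of "p ^ (n - i)"] isobaric_of_nat_mult_iff[of "p ^ i" c]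
    assms(1,3)
  by (simp flip: power_add)

definition witt_weight :: "nat \<Rightarrow> nat + nat \<Rightarrow> nat" where
  "witt_weight p = case_sum (\<lambda>i. p ^ i) (\<lambda>i. p ^ i)"

lemma isobaric_ghost_witt_var:
  assumes "0 < p" "\<And>i. witt_weight p (v i) = p ^ i"
  shows "isobaric (witt_weight p) (p ^ n) (ghost p (\<lambda>i. witt_var (v i)) n)"
  unfolding ghost_eq_ghost_component ghost_component_def witt_var_eq_zvar
  using isobaric_zvar[of "witt_weight p" "v _"] unfolding assms(2)
  by (intro isobaric_sum isobaric_ghost_summand assms(1)) auto

lemma isobaric_witt_add_poly:
  assumes p: "Factorial_Ring.prime p"
  shows "isobaric (witt_weight p) (p ^ n) (witt_add_poly p n)"
proof (induction n rule: less_induct)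
  case (less n)
  have "0 < p" using p by (rule prime_gt_0_nat)
  have "isobaric (witt_weight p) (p ^ n) (lower_ghost_sum p (witt_add_poly p) n)"
    unfolding lower_ghost_sum_def
    using less \<open>0 < p\<close> by (intro isobaric_sum isobaric_ghost_summand) auto
  then have "isobaric (witt_weight p) (p ^ n)
      (ghost p (witt_add_poly p) n - lower_ghost_sum p (witt_add_poly p) n)"
    unfolding ghost_witt_add_poly[OF p]
    by (intro isobaric_diff isobaric_add isobaric_ghost_witt_var \<open>0 < p\<close>)
      (simp_all add: witt_weight_def)
  also have "\<dots> = of_nat (p ^ n) * witt_add_poly p n"
    by (simp add: ghost_eq_ghost_component ghost_component_eq)
  finally show ?case using \<open>0 < p\<close> by (simp only: isobaric_of_nat_mult_iff zero_less_power)
qed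

lemma witt_weight_le_if_in_keys_witt_add_poly:
  assumes "Factorial_Ring.prime p" "m \<in> Poly_Mapping.keys (witt_add_poly p n)"
    and "v \<in> Poly_Mapping.keys m"
  shows "witt_weight p v \<le> p ^ n"
proof -
  have "witt_weight p v * 1 \<le> witt_weight p v * Poly_Mapping.lookup m v"
    using assms(3) by (intro mult_le_mono) (simp_all add: in_keys_iff)
  also have "\<dots> \<le> zweight (witt_weight p) m"
    unfolding zweight_def using assms(3) by (intro member_le_sum) simp_all
  also have "\<dots> = p ^ n"
    using isobaric_witt_add_poly[OF assms(1)] assms(2) by (simp add: isobaric_def)
  finally show ?thesis by simp
qed

lemma witt_weight_cases [consumes 2, case_names left right]:
  assumes "Factorial_Ring.prime p" "witt_weight p v \<le> p ^ n"
  obtains i where "v = Inl i" "i \<le> n" | i where "v = Inr i" "i \<le> n"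
  using assms power_le_imp_le_exp[OF prime_gt_1_nat[OF assms(1)]]
  by (cases v) (auto simp: witt_weight_def)

context power_multiplicative_ring begin

lemma norm_zmon_le:
  fixes f :: "'v \<Rightarrow> 'a"
  assumes f: "\<And>v. f v \<in> carrier R"
    and norm_f_le: "\<And>v. v \<in> Poly_Mapping.keys m \<Longrightarrow> N (f v) \<le> D ^ c v"
  shows "N (zmon R f m) \<le> D ^ zweight c m"
proof -
  have "N (zmon R f m) \<le> (\<Prod>v\<in>Poly_Mapping.keys m. N (f v [^] Poly_Mapping.lookup m v))"
    unfolding zmon_def by (rule norm_finprod_le) (simp add: f)
  also have "\<dots> \<le> (\<Prod>v\<in>Poly_Mapping.keys m. (D ^ c v) ^ Poly_Mapping.lookup m v)"
    using f norm_f_le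
    by (intro prod_mono) (auto intro: order_trans[OF norm_pow_le] power_mono norm_nonneg)
  also have "\<dots> = D ^ zweight c m"
    by (simp add: zweight_def power_sum power_mult)
  finally show ?thesis .
qed

end

context char_p_ring begin

lemma witt_add_eq_zeval: "(a \<oplus>\<^bsub>W\<^esub> b) n = zeval B (case_sum a b) (witt_add_poly p n)"
  by (simp add: witt_ring_def eval_witt_poly_eq_zeval)

lemma case_sum_closed:
  "a \<in> carrier W \<Longrightarrow> b \<in> carrier W \<Longrightarrow> case_sum a b v \<in> carrier B"
  by (cases v) auto

lemma witt_add_cong:
  assumes "a \<in> carrier W" "a' \<in> carrier W" "b \<in> carrier W"
    and "\<And>i. i \<le> n \<Longrightarrow> a i = a' i"
  shows "(a \<oplus>\<^bsub>W\<^esub> b) n = (a' \<oplus>\<^bsub>W\<^esub> b) n"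
  unfolding witt_add_eq_zeval
proof (rule zeval_cong)
  fix m v assume "m \<in> Poly_Mapping.keys (witt_add_poly p n)" "v \<in> Poly_Mapping.keys m"
  then have "witt_weight p v \<le> p ^ n" by (rule witt_weight_le_if_in_keys_witt_add_poly[OF p_prime])
  with p_prime show "case_sum a b v = case_sum a' b v"
    by (cases rule: witt_weight_cases) (simp_all add: assms(4))
qed (simp_all add: case_sum_closed assms)

definition witt_filtration :: "nat \<Rightarrow> (nat \<Rightarrow> 'a) set" where
  "witt_filtration n = {w \<in> carrier W. \<forall>i<n. w i = \<zero>}"

lemma witt_diff_in_filtration_iff:
  assumes a: "a \<in> carrier W" and b: "b \<in> carrier W"
  shows "a \<ominus>\<^bsub>W\<^esub> b \<in> witt_filtration n \<longleftrightarrow> (\<forall>i<n. a i = b i)"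
proof
  assume diff: "a \<ominus>\<^bsub>W\<^esub> b \<in> witt_filtration n"
  show "\<forall>i<n. a i = b i"
  proof (intro allI impI)
    fix i assume "i < n"
    have "a i = ((a \<ominus>\<^bsub>W\<^esub> b) \<oplus>\<^bsub>W\<^esub> b) i" by (simp only: W.minus_add_cancel[OF a b])
    also have "\<dots> = (\<zero>\<^bsub>W\<^esub> \<oplus>\<^bsub>W\<^esub> b) i"
      using diff \<open>i < n\<close>
      by (intro witt_add_cong W.minus_closed W.zero_closed a b)
        (simp add: witt_filtration_def witt_ring_simps(3))
    finally show "a i = b i" using b by simp
  qed
next
  assume "\<forall>i<n. a i = b i"
  then have "(a \<oplus>\<^bsub>W\<^esub> \<ominus>\<^bsub>W\<^esub> b) i = (b \<oplus>\<^bsub>W\<^esub> \<ominus>\<^bsub>W\<^esub> b) i" if "i < n" for i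
    using a b that by (intro witt_add_cong) simp_all
  then show "a \<ominus>\<^bsub>W\<^esub> b \<in> witt_filtration n"
    using a b by (simp add: W.minus_eq W.r_neg witt_filtration_def) (simp add: witt_ring_simps)
qed

lemma add_pow_p_power_teichmuller:
  assumes y: "y \<in> carrier B"
  shows "add_pow W (p ^ n) (teichmuller B y) = (\<lambda>i. if i = n then y [^] (p ^ n) else \<zero>)"
proof (induction n)
  case 0
  have "add_pow W (1::nat) (teichmuller B y) = teichmuller B y"
    by (rule W.add.nat_pow_eone) (use y in simp)
  then show ?case using nat_pow_eone[OF y] by (simp only: teichmuller_def power_0)
next
  case (Suc n)
  let ?v = "\<lambda>i. if i = n then y [^] (p ^ n) else \<zero>"
  have v: "?v \<in> carrier W" using y by (simp add: witt_ring_simps)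
  have "add_pow W (p ^ Suc n) (teichmuller B y) = add_pow W p (add_pow W (p ^ n) (teichmuller B y))"
    using y by (simp add: W.add.nat_pow_pow mult.commute)
  also have "\<dots> = (\<lambda>i. if i = Suc n then y [^] (p ^ Suc n) else \<zero>)"
    unfolding Suc add_pow_p_witt[OF v]
    using y by (auto simp: fun_eq_iff nat_pow_pow mult.commute nat_pow_zero split: nat.splits)
  finally show ?case .
qed

lemma teichmuller_partial_sum:
  assumes y: "\<And>n. y n \<in> carrier B"
  shows "(\<Oplus>\<^bsub>W\<^esub>n\<in>{..<k}. add_pow W (p ^ n) (teichmuller B (y n))) =
    (\<lambda>n. if n < k then y n [^] (p ^ n) else \<zero>)"
proof (induction k)
  case 0
  show ?case by (simp add: witt_ring_simps)
next
  case (Suc k)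
  let ?t = "\<lambda>n. add_pow W (p ^ n) (teichmuller B (y n))"
  let ?u = "\<lambda>n. if n < k then y n [^] (p ^ n) else \<zero>"
  have "(\<Oplus>\<^bsub>W\<^esub>n\<in>{..<Suc k}. ?t n) = ?t k \<oplus>\<^bsub>W\<^esub> (\<Oplus>\<^bsub>W\<^esub>n\<in>{..<k}. ?t n)"
    using y unfolding lessThan_Suc by (intro W.finsum_insert) auto
  also have "\<dots> = (\<lambda>i. if i = k then y k [^] (p ^ k) else \<zero>) \<oplus>\<^bsub>W\<^esub> ?u"
    by (subst Suc) (simp only: add_pow_p_power_teichmuller[OF y])
  also have "\<dots> = (\<lambda>i. (if i = k then y k [^] (p ^ k) else \<zero>) \<oplus> ?u i)"
    using y by (intro witt_add_disjoint) (auto simp: witt_ring_simps)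
  also have "\<dots> = (\<lambda>n. if n < Suc k then y n [^] (p ^ n) else \<zero>)"
    using y by (auto simp: fun_eq_iff less_Suc_eq)
  finally show ?case .
qed

end

subsection \<open>Teichmueller expansions over a perfect ring\<close>

locale perfect_char_p_ring = char_p_ring +
  assumes frobenius_bij: "bij_betw (\<lambda>x. x [^] p) (carrier B) (carrier B)"
begin

lemma frobenius_power_bij: "bij_betw (\<lambda>x. x [^] (p ^ k)) (carrier B) (carrier B)"
proof (induction k)
  case 0
  have "bij_betw (\<lambda>x. x [^] (1::nat)) (carrier B) (carrier B) \<longleftrightarrow> bij_betw id (carrier B) (carrier B)"
    by (rule bij_betw_cong) simp
  then show ?case by simp
next
  case (Suc k)
  have "bij_betw (\<lambda>x. x [^] (p ^ Suc k)) (carrier B) (carrier B) \<longleftrightarrow>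
      bij_betw ((\<lambda>x. x [^] (p ^ k)) \<circ> (\<lambda>x. x [^] p)) (carrier B) (carrier B)"
    by (rule bij_betw_cong) (simp add: nat_pow_pow)
  then show ?case using bij_betw_trans[OF frobenius_bij Suc] by blast
qed

definition frobenius_root :: "nat \<Rightarrow> 'a \<Rightarrow> 'a" where
  "frobenius_root k = inv_into (carrier B) (\<lambda>x. x [^] (p ^ k))"

lemma frobenius_root_closed [simp]: "x \<in> carrier B \<Longrightarrow> frobenius_root k x \<in> carrier B"
  unfolding frobenius_root_def using frobenius_power_bij
  by (metis bij_betw_imp_surj_on inv_into_into)

lemma frobenius_root_pow [simp]: "x \<in> carrier B \<Longrightarrow> frobenius_root k x [^] (p ^ k) = x"
  unfolding frobenius_root_def by (rule bij_betw_inv_into_right[OF frobenius_power_bij])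

lemma frobenius_root_eqI: "y \<in> carrier B \<Longrightarrow> y [^] (p ^ k) = x \<Longrightarrow> frobenius_root k x = y"
  unfolding frobenius_root_def using bij_betw_inv_into_left[OF frobenius_power_bij] by blast

lemma frobenius_root_zero [simp]: "frobenius_root k \<zero> = \<zero>"
  by (rule frobenius_root_eqI) simp_all

lemma frobenius_root_1_pow [simp]: "x \<in> carrier B \<Longrightarrow> frobenius_root 1 x [^] p = x"
  using frobenius_root_pow[of x 1] by simp

lemma frobenius_root_frobenius_root_1:
  assumes "x \<in> carrier B"
  shows "frobenius_root n (frobenius_root 1 x) = frobenius_root (Suc n) x"
proof (rule frobenius_root_eqI[symmetric])
  let ?y = "frobenius_root n (frobenius_root 1 x)"
  have "?y [^] (p ^ Suc n) = (?y [^] (p ^ n)) [^] p"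
    using assms by (simp add: nat_pow_pow mult.commute del: frobenius_root_pow)
  then show "?y [^] (p ^ Suc n) = x" using assms by (simp del: One_nat_def)
qed (use assms in simp)

definition teichmuller_coeff :: "(nat \<Rightarrow> 'a) \<Rightarrow> nat \<Rightarrow> 'a" where
  "teichmuller_coeff w n = frobenius_root n (w n)"

definition p_quotient :: "(nat \<Rightarrow> 'a) \<Rightarrow> nat \<Rightarrow> 'a" where
  "p_quotient w n = frobenius_root 1 (w (Suc n))"

context
  fixes w :: "nat \<Rightarrow> 'a"
  assumes w: "w \<in> carrier W"
begin

lemma teichmuller_coeff_closed: "teichmuller_coeff w n \<in> carrier B"
  using w by (simp add: teichmuller_coeff_def component_closed)

lemma teichmuller_coeff_pow: "teichmuller_coeff w n [^] (p ^ n) = w n"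
  using w by (simp add: teichmuller_coeff_def component_closed)

lemma p_quotient_closed: "p_quotient w \<in> carrier W"
  using w by (simp add: witt_ring_simps(1) p_quotient_def)

lemma teichmuller_decomposition:
  "w = teichmuller B (w 0) \<oplus>\<^bsub>W\<^esub> add_pow W p (p_quotient w)"
proof -
  have shift: "add_pow W p (p_quotient w) = case_nat \<zero> (\<lambda>n. w (Suc n))"
    unfolding add_pow_p_witt[OF p_quotient_closed] p_quotient_def
    using w by (simp add: component_closed del: One_nat_def)
  have "teichmuller B (w 0) \<oplus>\<^bsub>W\<^esub> case_nat \<zero> (\<lambda>n. w (Suc n)) =
      (\<lambda>n. teichmuller B (w 0) n \<oplus> case_nat \<zero> (\<lambda>n. w (Suc n)) n)"
    using w
    by (intro witt_add_disjoint) (auto simp: witt_ring_simps(1) teichmuller_def split: nat.splits)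
  also have "\<dots> = w"
    using w by (auto simp: witt_ring_simps(1) teichmuller_def fun_eq_iff split: nat.splits)
  finally show ?thesis by (simp only: shift)
qed

lemma teichmuller_coeff_p_quotient:
  "teichmuller_coeff (p_quotient w) n = teichmuller_coeff w (Suc n)"
  unfolding teichmuller_coeff_def p_quotient_def
  using w by (intro frobenius_root_frobenius_root_1 component_closed)

lemma teichmuller_coeff_add_pow_p:
  "teichmuller_coeff (add_pow W p w) 0 = \<zero>"
  "teichmuller_coeff (add_pow W p w) (Suc n) = teichmuller_coeff w n"
proof -
  have "teichmuller_coeff w n [^] (p ^ Suc n) = (teichmuller_coeff w n [^] (p ^ n)) [^] p"
    using teichmuller_coeff_closed by (simp add: nat_pow_pow mult.commute)
  then show "teichmuller_coeff (add_pow W p w) (Suc n) = teichmuller_coeff w n"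
    unfolding teichmuller_coeff_def[of "add_pow W p w"]
    unfolding add_pow_p_witt[OF w]
    by (intro frobenius_root_eqI teichmuller_coeff_closed) (simp add: teichmuller_coeff_pow)
qed (simp add: teichmuller_coeff_def add_pow_p_witt[OF w])

lemma teichmuller_coeff_teichmuller_mult:
  assumes "x \<in> carrier B"
  shows "teichmuller_coeff (teichmuller B x \<otimes>\<^bsub>W\<^esub> w) n = x \<otimes> teichmuller_coeff w n"
  unfolding teichmuller_coeff_def[of "_ \<otimes>\<^bsub>W\<^esub> _"]
  unfolding teichmuller_mult_witt[OF assms w]
  using assms teichmuller_coeff_closed
  by (intro frobenius_root_eqI) (simp_all add: nat_pow_distrib teichmuller_coeff_pow)

end

lemma witt_filtration_Suc: "witt_filtration (Suc n) = add_pow W p ` witt_filtration n"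
proof (intro equalityI subsetI)
  fix w assume "w \<in> witt_filtration (Suc n)"
  then have w: "w \<in> carrier W" "\<And>i. i < Suc n \<Longrightarrow> w i = \<zero>" by (auto simp: witt_filtration_def)
  then have "w = add_pow W p (p_quotient w)"
    using teichmuller_decomposition[OF w(1)] by (simp add: teichmuller_zero p_quotient_closed)
  moreover have "p_quotient w \<in> witt_filtration n"
    using w by (simp add: witt_filtration_def p_quotient_closed) (simp add: p_quotient_def)
  ultimately show "w \<in> add_pow W p ` witt_filtration n" by (rule image_eqI)
next
  fix w assume "w \<in> add_pow W p ` witt_filtration n"
  then obtain u where "u \<in> carrier W" "\<And>i. i < n \<Longrightarrow> u i = \<zero>" "w = add_pow W p u"
    by (auto simp: witt_filtration_def)
  then show "w \<in> witt_filtration (Suc n)"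
    by (auto simp: witt_filtration_def add_pow_p_witt nat_pow_zero split: nat.splits)
       (metis W.add.nat_pow_closed add_pow_p_witt)
qed

abbreviation p_ideal :: "(nat \<Rightarrow> 'a) set" where
  "p_ideal \<equiv> Idl\<^bsub>W\<^esub> {add_pow W p \<one>\<^bsub>W\<^esub>}"

lemma ideal_p_ideal: "ideal p_ideal W"
  by (rule W.genideal_ideal) simp

lemma p_ideal_power: "W.ideal_power p_ideal n = witt_filtration n"
proof (induction n)
  case 0
  show ?case by (simp only: W.ideal_power_0) (simp add: witt_filtration_def)
next
  case (Suc n)
  have "ideal (witt_filtration n) W" using W.ideal_ideal_power[OF ideal_p_ideal, of n] Suc by simp
  then have "W.ideal_power p_ideal (Suc n) = (\<lambda>w. w \<otimes>\<^bsub>W\<^esub> add_pow W p \<one>\<^bsub>W\<^esub>) ` witt_filtration n"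
    by (simp only: W.ideal_power_Suc Suc) (rule W.ideal_prod_genideal_singleton, simp_all)
  also have "\<dots> = add_pow W p ` witt_filtration n"
    by (rule image_cong) (simp_all add: W.add_pow_rdistr witt_filtration_def)
  finally show ?case by (simp only: witt_filtration_Suc)
qed

lemma limitin_p_adic_iff:
  assumes w: "w \<in> carrier W" and s: "\<And>k. s k \<in> carrier W"
  shows "limitin (adic_topology W p_ideal) s w F \<longleftrightarrow> (\<forall>i. \<forall>\<^sub>F k in F. s k i = w i)"
proof -
  have "limitin (adic_topology W p_ideal) s w F \<longleftrightarrow> (\<forall>n. \<forall>\<^sub>F k in F. \<forall>i\<in>{..<n}. s k i = w i)"
    unfolding W.limitin_adic_topology_iff[OF ideal_p_ideal w s] p_ideal_power
      witt_diff_in_filtration_iff[OF s w] by (simp add: Ball_def)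
  also have "\<dots> \<longleftrightarrow> (\<forall>i. \<forall>\<^sub>F k in F. s k i = w i)"
    unfolding eventually_ball_finite_distrib[OF finite_lessThan] by (meson lessI lessThan_iff)
  finally show ?thesis .
qed

lemma teichmuller_expansion_iff:
  assumes w: "w \<in> carrier W"
  shows "teichmuller_expansion p B w y \<longleftrightarrow> y = teichmuller_coeff w"
proof (cases "\<forall>n. y n \<in> carrier B")
  case True
  then have y: "y n \<in> carrier B" for n by blast
  let ?s = "\<lambda>k n. if n < k then y n [^] (p ^ n) else \<zero>"
  have s: "?s k \<in> carrier W" for k using y by (simp add: witt_ring_simps)
  have "teichmuller_expansion p B w y \<longleftrightarrow> limitin (adic_topology W p_ideal) ?s w sequentially"
    using y by (simp add: teichmuller_expansion_def teichmuller_partial_sum Let_def)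
  also have "\<dots> \<longleftrightarrow> (\<forall>n. \<forall>\<^sub>F k in sequentially. ?s k n = w n)"
    by (rule limitin_p_adic_iff[OF w s])
  also have "\<dots> \<longleftrightarrow> (\<forall>n. y n [^] (p ^ n) = w n)"
  proof (rule all_cong1)
    fix n
    have "(\<forall>\<^sub>F k in sequentially. ?s k n = w n) \<longleftrightarrow> (\<forall>\<^sub>F k in sequentially. y n [^] (p ^ n) = w n)"
      by (rule eventually_cong[OF eventually_gt_at_top[of n]]) simp
    then show "(\<forall>\<^sub>F k in sequentially. ?s k n = w n) \<longleftrightarrow> y n [^] (p ^ n) = w n" by simp
  qed
  also have "\<dots> \<longleftrightarrow> y = teichmuller_coeff w"
    using y teichmuller_coeff_pow[OF w]
    by (auto simp: fun_eq_iff teichmuller_coeff_def intro!: frobenius_root_eqI[symmetric])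
  finally show ?thesis .
next
  case False
  then show ?thesis using teichmuller_coeff_closed[OF w] by (auto simp: teichmuller_expansion_def)
qed

lemma gauss_norm_eq_SUP:
  "w \<in> carrier W \<Longrightarrow> gauss_norm p B N \<rho> w = (SUP n. \<rho> ^ n * N (teichmuller_coeff w n))"
  by (simp add: gauss_norm_def teichmuller_expansion_iff)

end

subsection \<open>The Gauss norm\<close>

locale perfect_normed_ring =
  perfect_char_p_ring B p + power_multiplicative_ring B N
  for B :: "('a, 'm) ring_scheme" (structure) and p :: nat and N :: "'a \<Rightarrow> real" +
  fixes \<rho> :: real
  assumes norm_le_1: "x \<in> carrier B \<Longrightarrow> N x \<le> 1"
    and rho: "0 < \<rho>" "\<rho> < 1"
begin

abbreviation G :: "(nat \<Rightarrow> 'a) \<Rightarrow> real" where "G \<equiv> gauss_norm p B N \<rho>"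

lemma norm_frobenius_root: "x \<in> carrier B \<Longrightarrow> N (frobenius_root k x) ^ (p ^ k) = N x"
  by (simp flip: norm_pow)

context
  fixes w :: "nat \<Rightarrow> 'a"
  assumes w: "w \<in> carrier W"
begin

lemma norm_teichmuller_coeff_nonneg: "0 \<le> N (teichmuller_coeff w n)"
  by (intro norm_nonneg teichmuller_coeff_closed w)

lemma norm_teichmuller_coeff_pow: "N (teichmuller_coeff w n) ^ (p ^ n) = N (w n)"
  unfolding teichmuller_coeff_def by (intro norm_frobenius_root component_closed w)

lemma weighted_coeff_le_1: "\<rho> ^ n * N (teichmuller_coeff w n) \<le> 1"
proof -
  have "\<rho> ^ n * N (teichmuller_coeff w n) \<le> 1 * 1"
    using rho
    by (intro mult_mono norm_le_1 norm_teichmuller_coeff_nonneg teichmuller_coeff_closed w)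
      (simp_all add: power_le_one)
  then show ?thesis by simp
qed

lemma gauss_norm_le_iff: "G w \<le> c \<longleftrightarrow> (\<forall>n. \<rho> ^ n * N (teichmuller_coeff w n) \<le> c)"
proof -
  have "bdd_above (range (\<lambda>n. \<rho> ^ n * N (teichmuller_coeff w n)))"
    using weighted_coeff_le_1 by (rule bdd_aboveI2)
  then show ?thesis unfolding gauss_norm_eq_SUP[OF w] by (simp add: cSUP_le_iff)
qed

lemma weighted_coeff_le_gauss_norm: "\<rho> ^ n * N (teichmuller_coeff w n) \<le> G w"
  using gauss_norm_le_iff[of "G w"] by simp

lemma gauss_norm_nonneg: "0 \<le> G w"
  using weighted_coeff_le_gauss_norm[of 0] norm_teichmuller_coeff_nonneg[of 0] by simp

lemma gauss_norm_le_1: "G w \<le> 1"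
  by (simp add: gauss_norm_le_iff weighted_coeff_le_1)

lemma gauss_norm_eq_0_iff: "G w = 0 \<longleftrightarrow> w = \<zero>\<^bsub>W\<^esub>"
proof -
  have "\<rho> ^ n * N (teichmuller_coeff w n) \<le> 0 \<longleftrightarrow> N (teichmuller_coeff w n) ^ (p ^ n) = 0" for n
    using zero_less_power[OF rho(1), of n] norm_teichmuller_coeff_nonneg[of n]
    by (auto simp: mult_le_0_iff)
  then have "\<rho> ^ n * N (teichmuller_coeff w n) \<le> 0 \<longleftrightarrow> w n = \<zero>" for n
    by (simp only: norm_teichmuller_coeff_pow norm_eq_0_iff[OF component_closed[OF w]])
  then have "G w \<le> 0 \<longleftrightarrow> w = \<zero>\<^bsub>W\<^esub>"
    unfolding gauss_norm_le_iff by (simp add: witt_ring_simps fun_eq_iff)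
  then show ?thesis using gauss_norm_nonneg by (simp add: order_antisym_conv)
qed

lemma norm_teichmuller_coeff_le:
  assumes "i \<le> n"
  shows "N (teichmuller_coeff w i) \<le> G w / \<rho> ^ n"
proof -
  have "\<rho> ^ n * N (teichmuller_coeff w i) \<le> \<rho> ^ i * N (teichmuller_coeff w i)"
    using rho assms
    by (intro mult_right_mono power_decreasing norm_teichmuller_coeff_nonneg) simp_all
  also have "\<dots> \<le> G w" by (rule weighted_coeff_le_gauss_norm)
  finally show ?thesis using rho by (simp add: field_simps)
qed

end

lemma gauss_norm_teichmuller_mult_le:
  assumes x: "x \<in> carrier B" and w: "w \<in> carrier W"
  shows "G (teichmuller B x \<otimes>\<^bsub>W\<^esub> w) \<le> N x * G w"
proof -
  have "\<rho> ^ n * N (x \<otimes> teichmuller_coeff w n) \<le> N x * G w" for n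
  proof -
    have "\<rho> ^ n * N (x \<otimes> teichmuller_coeff w n) \<le> \<rho> ^ n * (N x * N (teichmuller_coeff w n))"
      using rho by (intro mult_left_mono norm_mult x teichmuller_coeff_closed w) simp
    also have "\<dots> = N x * (\<rho> ^ n * N (teichmuller_coeff w n))" by simp
    also have "\<dots> \<le> N x * G w"
      by (intro mult_left_mono weighted_coeff_le_gauss_norm norm_nonneg x w)
    finally show ?thesis .
  qed
  then show ?thesis
    using x w by (simp add: gauss_norm_le_iff teichmuller_coeff_teichmuller_mult)
qed

lemma gauss_norm_add_pow_p_le:
  assumes w: "w \<in> carrier W"
  shows "G (add_pow W p w) \<le> \<rho> * G w"
proof -
  have "\<rho> ^ n * N (teichmuller_coeff (add_pow W p w) n) \<le> \<rho> * G w" for n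
    using rho w gauss_norm_nonneg[OF w] weighted_coeff_le_gauss_norm[OF w]
    by (cases n) (simp_all add: teichmuller_coeff_add_pow_p mult.assoc)
  then show ?thesis using w by (simp add: gauss_norm_le_iff)
qed

lemma gauss_norm_p_quotient_le:
  assumes w: "w \<in> carrier W"
  shows "\<rho> * G (p_quotient w) \<le> G w"
proof -
  have "\<rho> ^ n * N (teichmuller_coeff (p_quotient w) n) \<le> G w / \<rho>" for n
    using weighted_coeff_le_gauss_norm[OF w, of "Suc n"] rho
    by (simp add: teichmuller_coeff_p_quotient[OF w] field_simps)
  then have "G (p_quotient w) \<le> G w / \<rho>" by (simp add: gauss_norm_le_iff p_quotient_closed[OF w])
  then show ?thesis using rho by (simp add: field_simps)
qed

lemma norm_teichmuller_coeff_add_le: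
  assumes a: "a \<in> carrier W" and b: "b \<in> carrier W" and "0 \<le> D"
    and coeffs_le: "\<And>i. i \<le> n \<Longrightarrow> N (teichmuller_coeff a i) \<le> D"
      "\<And>i. i \<le> n \<Longrightarrow> N (teichmuller_coeff b i) \<le> D"
  shows "N (teichmuller_coeff (a \<oplus>\<^bsub>W\<^esub> b) n) \<le> D"
proof -
  have component_le: "N (c i) \<le> D ^ (p ^ i)"
    if "c \<in> carrier W" "N (teichmuller_coeff c i) \<le> D" for c i
    using that
    by (simp add: power_mono norm_teichmuller_coeff_nonneg flip: norm_teichmuller_coeff_pow)
  have "N ((a \<oplus>\<^bsub>W\<^esub> b) n) \<le> D ^ (p ^ n)"
    unfolding witt_add_eq_zeval
  proof (rule norm_zeval_le)
    fix m assume m: "m \<in> Poly_Mapping.keys (witt_add_poly p n)"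
    have "N (case_sum a b v) \<le> D ^ witt_weight p v" if "v \<in> Poly_Mapping.keys m" for v
      using p_prime witt_weight_le_if_in_keys_witt_add_poly[OF p_prime m that]
      by (cases rule: witt_weight_cases) (simp_all add: witt_weight_def component_le a b coeffs_le)
    then have "N (zmon B (case_sum a b) m) \<le> D ^ zweight (witt_weight p) m"
      by (intro norm_zmon_le case_sum_closed a b)
    also have "zweight (witt_weight p) m = p ^ n"
      using isobaric_witt_add_poly[OF p_prime] m by (simp add: isobaric_def)
    finally show "N (zmon B (case_sum a b) m) \<le> D ^ (p ^ n)" .
  qed (simp_all add: case_sum_closed a b \<open>0 \<le> D\<close>)
  then have "N (teichmuller_coeff (a \<oplus>\<^bsub>W\<^esub> b) n) ^ (p ^ n) \<le> D ^ (p ^ n)"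
    using a b by (simp add: norm_teichmuller_coeff_pow)
  then show ?thesis
    using a b \<open>0 \<le> D\<close> by (simp add: power_mono_iff norm_teichmuller_coeff_nonneg)
qed

lemma gauss_norm_add:
  assumes a: "a \<in> carrier W" and b: "b \<in> carrier W"
  shows "G (a \<oplus>\<^bsub>W\<^esub> b) \<le> max (G a) (G b)"
proof -
  let ?M = "max (G a) (G b)"
  have "N (teichmuller_coeff (a \<oplus>\<^bsub>W\<^esub> b) n) \<le> ?M / \<rho> ^ n" for n
  proof (rule norm_teichmuller_coeff_add_le[OF a b])
    have "G a / \<rho> ^ n \<le> ?M / \<rho> ^ n" "G b / \<rho> ^ n \<le> ?M / \<rho> ^ n"
      using rho by (simp_all add: divide_right_mono)
    then show "N (teichmuller_coeff a i) \<le> ?M / \<rho> ^ n" "N (teichmuller_coeff b i) \<le> ?M / \<rho> ^ n"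
      if "i \<le> n" for i
      using norm_teichmuller_coeff_le[OF a that] norm_teichmuller_coeff_le[OF b that] by simp_all
    show "0 \<le> ?M / \<rho> ^ n" using rho gauss_norm_nonneg[OF a] by simp
  qed
  then show ?thesis using a b rho by (simp add: gauss_norm_le_iff field_simps)
qed

text \<open>Iterating \<open>a b = [a\<^sub>0] b + p (a' b)\<close> pushes the defect of submultiplicativity into
  \<open>p\<^sup>k W\<close>.\<close>

lemma gauss_norm_mult_le_max:
  assumes "a \<in> carrier W" and b: "b \<in> carrier W"
  shows "G (a \<otimes>\<^bsub>W\<^esub> b) \<le> max (G a * G b) (\<rho> ^ k)"
  using assms(1)
proof (induction k arbitrary: a)
  case 0
  then show ?case using b by (simp add: gauss_norm_le_1 le_max_iff_disj)
next
  case (Suc k)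
  let ?a' = "p_quotient a" and ?t = "teichmuller B (a 0)"
  note a = Suc.prems and a'_closed = p_quotient_closed[OF Suc.prems]
  have t_closed: "?t \<in> carrier W" using a by (simp add: component_closed)
  have "a \<otimes>\<^bsub>W\<^esub> b = (?t \<oplus>\<^bsub>W\<^esub> add_pow W p ?a') \<otimes>\<^bsub>W\<^esub> b"
    using teichmuller_decomposition[OF a] by (rule arg_cong)
  also have "\<dots> = ?t \<otimes>\<^bsub>W\<^esub> b \<oplus>\<^bsub>W\<^esub> add_pow W p (?a' \<otimes>\<^bsub>W\<^esub> b)"
    using t_closed a'_closed b by (simp add: W.l_distr W.add_pow_ldistr)
  finally have "G (a \<otimes>\<^bsub>W\<^esub> b) \<le> max (G (?t \<otimes>\<^bsub>W\<^esub> b)) (G (add_pow W p (?a' \<otimes>\<^bsub>W\<^esub> b)))"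
    using t_closed a'_closed b by (simp add: gauss_norm_add)
  also have "\<dots> \<le> max (G a * G b) (\<rho> ^ Suc k)"
  proof (rule max.boundedI)
    have "G (?t \<otimes>\<^bsub>W\<^esub> b) \<le> N (a 0) * G b"
      using a b by (intro gauss_norm_teichmuller_mult_le component_closed)
    also have "\<dots> \<le> G a * G b"
      using weighted_coeff_le_gauss_norm[OF a, of 0] norm_teichmuller_coeff_pow[OF a, of 0]
      by (intro mult_right_mono gauss_norm_nonneg b) simp
    finally show "G (?t \<otimes>\<^bsub>W\<^esub> b) \<le> max (G a * G b) (\<rho> ^ Suc k)" by simp
    have "G (add_pow W p (?a' \<otimes>\<^bsub>W\<^esub> b)) \<le> \<rho> * G (?a' \<otimes>\<^bsub>W\<^esub> b)"
      using a'_closed b by (intro gauss_norm_add_pow_p_le) simp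
    also have "\<dots> \<le> \<rho> * max (G ?a' * G b) (\<rho> ^ k)"
      using rho by (intro mult_left_mono Suc.IH a'_closed) simp
    also have "\<dots> = max (\<rho> * G ?a' * G b) (\<rho> ^ Suc k)"
      using rho by (simp add: max_mult_distrib_left mult.assoc)
    also have "\<dots> \<le> max (G a * G b) (\<rho> ^ Suc k)"
      by (intro max.mono mult_right_mono gauss_norm_p_quotient_le gauss_norm_nonneg a b order_refl)
    finally show "G (add_pow W p (?a' \<otimes>\<^bsub>W\<^esub> b)) \<le> max (G a * G b) (\<rho> ^ Suc k)" .
  qed
  finally show ?case .
qed

lemma gauss_norm_mult:
  assumes a: "a \<in> carrier W" and b: "b \<in> carrier W"
  shows "G (a \<otimes>\<^bsub>W\<^esub> b) \<le> G a * G b"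
proof (rule ccontr)
  assume greater: "\<not> G (a \<otimes>\<^bsub>W\<^esub> b) \<le> G a * G b"
  have "0 \<le> G a * G b" using a b by (simp add: gauss_norm_nonneg)
  then obtain k where "\<rho> ^ k < G (a \<otimes>\<^bsub>W\<^esub> b)"
    using greater rho real_arch_pow_inv[of "G (a \<otimes>\<^bsub>W\<^esub> b)" \<rho>] by auto
  then show False using gauss_norm_mult_le_max[OF a b, of k] greater by auto
qed

lemma gauss_norm_uminus_le:
  assumes "a \<in> carrier W"
  shows "G (\<ominus>\<^bsub>W\<^esub> a) \<le> G a"
proof -
  have "G (\<ominus>\<^bsub>W\<^esub> a) \<le> G (\<ominus>\<^bsub>W\<^esub> \<one>\<^bsub>W\<^esub>) * G a"
    using gauss_norm_mult[of "\<ominus>\<^bsub>W\<^esub> \<one>\<^bsub>W\<^esub>" a] assms by (simp add: W.l_minus)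
  also have "\<dots> \<le> 1 * G a"
    using assms by (intro mult_right_mono gauss_norm_le_1 gauss_norm_nonneg) simp_all
  finally show ?thesis by simp
qed

lemma ultrametric_ring_gauss_norm: "ultrametric_ring W G"
proof
  fix a b assume a: "a \<in> carrier W" and b: "b \<in> carrier W"
  have "G (a \<ominus>\<^bsub>W\<^esub> b) \<le> max (G a) (G (\<ominus>\<^bsub>W\<^esub> b))"
    unfolding W.minus_eq using a b by (intro gauss_norm_add) simp_all
  also have "\<dots> \<le> max (G a) (G b)" using b by (intro max.mono gauss_norm_uminus_le) simp_all
  finally show "G (a \<ominus>\<^bsub>W\<^esub> b) \<le> max (G a) (G b)" .
qed (simp_all add: gauss_norm_nonneg gauss_norm_eq_0_iff gauss_norm_mult)

sublocale gauss: ultrametric_ring W G by (rule ultrametric_ring_gauss_norm)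

lemma gauss_norm_teichmuller_le:
  assumes "x \<in> carrier B"
  shows "G (teichmuller B x) \<le> N x"
proof -
  have "G (teichmuller B x) \<le> N x * G \<one>\<^bsub>W\<^esub>"
    using gauss_norm_teichmuller_mult_le[OF assms W.one_closed] assms by simp
  also have "\<dots> \<le> N x * 1" by (intro mult_left_mono gauss_norm_le_1 norm_nonneg assms) simp
  finally show ?thesis by simp
qed

lemma gauss_norm_p_le: "G (add_pow W p \<one>\<^bsub>W\<^esub>) \<le> \<rho>"
proof -
  have "G (add_pow W p \<one>\<^bsub>W\<^esub>) \<le> \<rho> * G \<one>\<^bsub>W\<^esub>" by (rule gauss_norm_add_pow_p_le) simp
  also have "\<dots> \<le> \<rho> * 1" using rho by (intro mult_left_mono gauss_norm_le_1) simp_all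
  finally show ?thesis by simp
qed

end

subsection \<open>Comparison of the topologies\<close>

context perfect_char_p_ring begin

text \<open>An ideal \<open>J\<close> containing the kernel of \<open>w \<mapsto> w\<^sub>0\<close> is the preimage of its image in \<open>B\<close>.\<close>

lemma teichmuller_in_ideal:
  assumes J: "ideal J W" "witt_filtration 1 \<subseteq> J" and S: "teichmuller B ` S \<subseteq> J" and z: "z \<in> Idl S"
  shows "teichmuller B z \<in> J"
proof -
  interpret component_0: ring_hom_ring W B "\<lambda>w. w 0" by (rule component_0_ring_hom)
  have "(\<lambda>w. w 0) ` carrier W = carrier B"
    by (auto intro: rev_image_eqI[OF teichmuller_closed])
  then have "ideal ((\<lambda>w. w 0) ` J) B" by (rule component_0.ideal_image_if_surj[OF J(1)])
  moreover have "S \<subseteq> (\<lambda>w. w 0) ` J"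
    using S by (auto intro!: rev_image_eqI[of "teichmuller B x" for x])
  ultimately have "Idl S \<subseteq> (\<lambda>w. w 0) ` J" by (rule genideal_minimal)
  then obtain j where j: "j \<in> J" "z = j 0" using z by blast
  have j_closed: "j \<in> carrier W" using J(1) j(1) by (rule ideal.Icarr)
  then have z_closed: "teichmuller B z \<in> carrier W"
    unfolding j(2) by (intro teichmuller_closed component_closed)
  have "teichmuller B z \<ominus>\<^bsub>W\<^esub> j \<in> witt_filtration 1"
    unfolding witt_diff_in_filtration_iff[OF z_closed j_closed] by (simp add: j(2))
  then have "(teichmuller B z \<ominus>\<^bsub>W\<^esub> j) \<oplus>\<^bsub>W\<^esub> j \<in> J"
    using J(2) j(1) by (intro W.ideal_plus_closed[OF J(1)]) blast+
  then show ?thesis by (simp only: W.minus_add_cancel[OF z_closed j_closed])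
qed

lemma teichmuller_in_ideal_power:
  assumes J: "ideal J W" "witt_filtration 1 \<subseteq> J" and S: "teichmuller B ` S \<subseteq> J"
    and y: "y \<in> carrier B" "frobenius_root k y \<in> Idl S"
  shows "teichmuller B y \<in> W.ideal_power J k"
proof -
  have "teichmuller B (frobenius_root k y) [^]\<^bsub>W\<^esub> (p ^ k) \<in> W.ideal_power J (p ^ k)"
    by (intro W.pow_mem_ideal_power teichmuller_in_ideal[OF J S] J(1) y(2))
  also have "teichmuller B (frobenius_root k y) [^]\<^bsub>W\<^esub> (p ^ k) = teichmuller B y"
    using y(1) by (simp flip: teichmuller_pow)
  finally show ?thesis using W.ideal_power_antimono[OF J(1) le_prime_power] by blast
qed

lemma mem_ideal_if_teichmuller_coeffs:
  assumes J: "ideal J W" "witt_filtration k \<subseteq> J" and w: "w \<in> carrier W"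
    and coeffs: "\<And>n. n < k \<Longrightarrow> teichmuller B (teichmuller_coeff w n) \<in> J"
  shows "w \<in> J"
proof -
  let ?t = "\<lambda>n. teichmuller B (teichmuller_coeff w n)"
  let ?s = "\<Oplus>\<^bsub>W\<^esub>n\<in>{..<k}. add_pow W (p ^ n) (?t n)"
  have "add_pow W (p ^ n) (?t n) = ?t n \<otimes>\<^bsub>W\<^esub> add_pow W (p ^ n) \<one>\<^bsub>W\<^esub>" for n
    using teichmuller_coeff_closed[OF w] by (simp add: W.add_pow_rdistr)
  then have sum_in_J: "?s \<in> J"
    using coeffs by (intro W.ideal_finsum_closed J(1)) (simp add: ideal.I_r_closed[OF J(1)])
  then have sum_closed: "?s \<in> carrier W" by (rule ideal.Icarr[OF J(1)])
  have partial_sum: "?s = (\<lambda>n. if n < k then w n else \<zero>)"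
    using teichmuller_partial_sum[OF teichmuller_coeff_closed[OF w]]
    by (simp only: teichmuller_coeff_pow[OF w])
  have "w \<ominus>\<^bsub>W\<^esub> ?s \<in> witt_filtration k"
    unfolding witt_diff_in_filtration_iff[OF w sum_closed] unfolding partial_sum by simp
  then have "(w \<ominus>\<^bsub>W\<^esub> ?s) \<oplus>\<^bsub>W\<^esub> ?s \<in> J"
    using J(2) sum_in_J by (intro W.ideal_plus_closed[OF J(1)]) blast+
  then show ?thesis by (simp only: W.minus_add_cancel[OF w sum_closed])
qed

definition p_teichmuller_ideal :: "'a set \<Rightarrow> (nat \<Rightarrow> 'a) set" where
  "p_teichmuller_ideal S = Idl\<^bsub>W\<^esub> ({add_pow W p \<one>\<^bsub>W\<^esub>} \<union> teichmuller B ` S)"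

context
  fixes S :: "'a set"
  assumes S: "S \<subseteq> carrier B"
begin

lemma p_teichmuller_generators_closed: "{add_pow W p \<one>\<^bsub>W\<^esub>} \<union> teichmuller B ` S \<subseteq> carrier W"
  using S by auto

lemma ideal_p_teichmuller_ideal: "ideal (p_teichmuller_ideal S) W"
  unfolding p_teichmuller_ideal_def by (rule W.genideal_ideal[OF p_teichmuller_generators_closed])

lemma p_in_p_teichmuller_ideal: "add_pow W p \<one>\<^bsub>W\<^esub> \<in> p_teichmuller_ideal S"
  and teichmuller_subset_p_teichmuller_ideal: "teichmuller B ` S \<subseteq> p_teichmuller_ideal S"
  using W.genideal_self[OF p_teichmuller_generators_closed]
  unfolding p_teichmuller_ideal_def by auto

lemma witt_filtration_subset_p_teichmuller_ideal_power:
  "witt_filtration n \<subseteq> W.ideal_power (p_teichmuller_ideal S) n"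
proof -
  have "p_ideal \<subseteq> p_teichmuller_ideal S"
    using p_in_p_teichmuller_ideal by (intro W.genideal_minimal ideal_p_teichmuller_ideal) simp
  then show ?thesis using W.ideal_power_mono[of p_ideal] by (simp only: p_ideal_power)
qed

lemma witt_filtration_1_subset_p_teichmuller_ideal: "witt_filtration 1 \<subseteq> p_teichmuller_ideal S"
  using witt_filtration_subset_p_teichmuller_ideal_power[of 1]
  by (simp only: W.ideal_power_1[OF ideal_p_teichmuller_ideal])

end

end

context perfect_normed_ring begin

context
  fixes S :: "'a set"
  assumes S: "S \<subseteq> carrier B"
begin

lemma mem_p_teichmuller_ideal_power_if_gauss_norm_small:
  assumes "\<delta> > 0" and ball_subset: "\<And>b. b \<in> carrier B \<Longrightarrow> N b < \<delta> \<Longrightarrow> b \<in> Idl S"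
    and w: "w \<in> carrier W" and small: "G w < \<rho> ^ k * \<delta> ^ (p ^ k)"
  shows "w \<in> W.ideal_power (p_teichmuller_ideal S) k"
proof (rule mem_ideal_if_teichmuller_coeffs)
  fix n assume "n < k"
  let ?y = "teichmuller_coeff w n"
  have y_closed: "?y \<in> carrier B" by (rule teichmuller_coeff_closed[OF w])
  have "N (frobenius_root k ?y) ^ (p ^ k) = N ?y" by (rule norm_frobenius_root[OF y_closed])
  also have "\<dots> \<le> G w / \<rho> ^ k" using \<open>n < k\<close> by (intro norm_teichmuller_coeff_le w) simp
  also have "\<dots> < \<delta> ^ (p ^ k)" using small rho by (simp add: field_simps)
  finally have "N (frobenius_root k ?y) < \<delta>"
    using \<open>\<delta> > 0\<close> by (meson less_imp_le power_less_imp_less_base)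
  then have "frobenius_root k ?y \<in> Idl S" using y_closed by (intro ball_subset) simp_all
  then show "teichmuller B ?y \<in> W.ideal_power (p_teichmuller_ideal S) k"
    by (rule teichmuller_in_ideal_power[OF ideal_p_teichmuller_ideal[OF S]
          witt_filtration_1_subset_p_teichmuller_ideal[OF S]
          teichmuller_subset_p_teichmuller_ideal[OF S] y_closed])
qed (intro W.ideal_ideal_power ideal_p_teichmuller_ideal S
    witt_filtration_subset_p_teichmuller_ideal_power w)+

lemma gauss_norm_le_if_mem_p_teichmuller_ideal:
  assumes "\<rho> \<le> c" "\<And>x. x \<in> S \<Longrightarrow> N x \<le> c" and w: "w \<in> p_teichmuller_ideal S"
  shows "G w \<le> c"
proof -
  have "p_teichmuller_ideal S \<subseteq> {w \<in> carrier W. G w \<le> c}"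
    unfolding p_teichmuller_ideal_def
  proof (intro W.genideal_minimal gauss.ideal_norm_cball gauss_norm_le_1)
    show "{add_pow W p \<one>\<^bsub>W\<^esub>} \<union> teichmuller B ` S \<subseteq> {w \<in> carrier W. G w \<le> c}"
      using S assms(1,2) gauss_norm_p_le gauss_norm_teichmuller_le by (auto intro: order_trans)
  qed (use rho assms(1) in simp_all)
  then show ?thesis using w by blast
qed

theorem gauss_norm_topology_eq_adic_topology:
  assumes finite: "finite S" and less_1: "\<And>x. x \<in> S \<Longrightarrow> N x < 1"
    and "\<delta> > 0" and ball_subset: "\<And>b. b \<in> carrier B \<Longrightarrow> N b < \<delta> \<Longrightarrow> b \<in> Idl S"
  shows "norm_topology W G = adic_topology W (p_teichmuller_ideal S)"
proof (rule gauss.norm_topology_eq_adic_topology[OF ideal_p_teichmuller_ideal[OF S]])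
  fix k
  show "\<exists>r>0. \<forall>w\<in>carrier W. G w < r \<longrightarrow> w \<in> W.ideal_power (p_teichmuller_ideal S) k"
    using mem_p_teichmuller_ideal_power_if_gauss_norm_small[OF \<open>\<delta> > 0\<close> ball_subset] rho \<open>\<delta> > 0\<close>
    by (intro exI[of _ "\<rho> ^ k * \<delta> ^ (p ^ k)"]) simp
next
  fix r :: real assume "r > 0"
  define c where "c = Max (insert \<rho> (N ` S))"
  have c_bounds: "\<rho> \<le> c" "\<And>x. x \<in> S \<Longrightarrow> N x \<le> c" "c < 1"
    unfolding c_def using rho finite less_1 by (auto intro!: Max_ge simp del: Max_insert)
  then obtain n where "c ^ n < r" using real_arch_pow_inv[OF \<open>r > 0\<close>] by blast
  moreover have "G w \<le> c ^ n" if "w \<in> W.ideal_power (p_teichmuller_ideal S) n" for w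
    using c_bounds rho(1) that
    by (intro gauss.norm_ideal_power_le[OF gauss_norm_le_1 _ ideal_p_teichmuller_ideal[OF S]
          gauss_norm_le_if_mem_p_teichmuller_ideal]) simp_all
  ultimately show "\<exists>n. \<forall>w\<in>W.ideal_power (p_teichmuller_ideal S) n. G w < r"
    by (meson order_le_less_trans)
qed

end

end

subsection \<open>Subrings dense in an adic topology\<close>

lemma set_add_mono: "H \<subseteq> H' \<Longrightarrow> K \<subseteq> K' \<Longrightarrow> H <+>\<^bsub>G\<^esub> K \<subseteq> H' <+>\<^bsub>G\<^esub> K'"
  unfolding set_add_def by (rule mono_set_mult)

context cring begin

lemma ideal_power_add:
  assumes "ideal I R"
  shows "ideal_prod R (ideal_power I m) (ideal_power I n) = ideal_power I (m + n)"
proof -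
  interpret ideals: comm_monoid "ideals_set R" by (rule ideals_set_is_comm_monoid)
  show ?thesis using ideals.nat_pow_mult[of I m n] assms by (simp add: ideals_set_def)
qed

context
  fixes S I :: "'a set"
  assumes S: "subring S R" and I: "ideal I R"
begin

lemma subring_add_ideal_power_closed:
  assumes "x \<in> S <+>\<^bsub>R\<^esub> ideal_power I n" "y \<in> S <+>\<^bsub>R\<^esub> ideal_power I n"
  shows "x \<oplus> y \<in> S <+>\<^bsub>R\<^esub> ideal_power I n"
proof -
  have "additive_subgroup (S <+>\<^bsub>R\<^esub> ideal_power I n) R"
    by (rule add_additive_subgroups[OF additive_subgroup.intro[OF subring.axioms(1)[OF S]]
          ideal.axioms(1)[OF ideal_ideal_power[OF I]]])
  then show ?thesis using assms by (rule additive_subgroup.a_closed)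
qed

lemma mult_in_subring_add_ideal_power:
  assumes a: "a \<in> ideal_power I (Suc n)" "a \<in> S <+>\<^bsub>R\<^esub> ideal_power I (Suc (Suc n))"
    and b: "b \<in> I" "b \<in> S <+>\<^bsub>R\<^esub> ideal_power I 2"
  shows "a \<otimes> b \<in> S <+>\<^bsub>R\<^esub> ideal_power I (Suc (Suc (Suc n)))"
proof -
  let ?K = "ideal_power I (Suc (Suc (Suc n)))"
  obtain s i where decomp_a: "a = s \<oplus> i" "s \<in> S" "i \<in> ideal_power I (Suc (Suc n))"
    using a(2) unfolding set_add_def' by blast
  obtain t j where decomp_b: "b = t \<oplus> j" "t \<in> S" "j \<in> ideal_power I 2"
    using b(2) unfolding set_add_def' by blast
  have carriers: "s \<in> carrier R" "i \<in> carrier R" "t \<in> carrier R" "j \<in> carrier R" "a \<in> carrier R"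
    using subringE(1)[OF S] decomp_a(2) decomp_b(2) ideal_power_closed[OF I decomp_a(3)]
      ideal_power_closed[OF I decomp_b(3)] ideal_power_closed[OF I a(1)] by blast+
  have "j \<in> I" using decomp_b(3) ideal_power_antimono[OF I, of 1 2] ideal_power_1[OF I] by auto
  then have "b \<ominus> j \<in> I" by (rule ideal_minus_closed[OF I b(1)])
  then have "t \<in> I" unfolding decomp_b(1) using carriers by (simp add: minus_eq a_assoc r_neg)
  with decomp_a(3) have "i \<otimes> t \<in> ?K"
    unfolding ideal_power_Suc[of I "Suc (Suc n)"] by (rule ideal_prod.prod)
  moreover have "a \<otimes> j \<in> ?K"
    using ideal_prod.prod[OF a(1) decomp_b(3), of R]
    by (simp only: ideal_power_add[OF I] add_2_eq_Suc')
  ultimately have "i \<otimes> t \<oplus> a \<otimes> j \<in> ?K" by (rule ideal_plus_closed[OF ideal_ideal_power[OF I]])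
  moreover have "a \<otimes> b = s \<otimes> t \<oplus> (i \<otimes> t \<oplus> a \<otimes> j)"
    using carriers unfolding decomp_a(1) decomp_b(1) by algebra
  ultimately show ?thesis
    using subringE(6)[OF S decomp_a(2) decomp_b(2)] unfolding set_add_def' by blast
qed

lemma ideal_power_Suc_subset_subring_add:
  assumes "I \<subseteq> S <+>\<^bsub>R\<^esub> ideal_power I 2"
  shows "ideal_power I (Suc n) \<subseteq> S <+>\<^bsub>R\<^esub> ideal_power I (Suc (Suc n))"
proof (induction n)
  case 0
  show ?case using assms ideal_power_1[OF I] by (simp add: numeral_2_eq_2)
next
  case (Suc n)
  show ?case
  proof
    fix x assume "x \<in> ideal_power I (Suc (Suc n))"
    then have "x \<in> ideal_prod R (ideal_power I (Suc n)) I" by (simp only: ideal_power_Suc)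
    then show "x \<in> S <+>\<^bsub>R\<^esub> ideal_power I (Suc (Suc (Suc n)))"
    proof (induction rule: ideal_prod.induct)
      case (prod a b)
      then show ?case using Suc assms by (intro mult_in_subring_add_ideal_power) blast+
    qed (rule subring_add_ideal_power_closed)
  qed
qed

lemma carrier_subset_subring_add_ideal_power:
  assumes "carrier R \<subseteq> S <+>\<^bsub>R\<^esub> ideal_power I 2"
  shows "carrier R \<subseteq> S <+>\<^bsub>R\<^esub> ideal_power I n"
proof (induction n)
  case 0
  show ?case using subringE(2)[OF S] unfolding ideal_power_0 set_add_def' by force
next
  case (Suc n)
  have subset: "ideal_power I n \<subseteq> S <+>\<^bsub>R\<^esub> ideal_power I (Suc n)"
  proof (cases n)
    case 0
    have "S <+>\<^bsub>R\<^esub> ideal_power I 2 \<subseteq> S <+>\<^bsub>R\<^esub> ideal_power I 1"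
      by (intro set_add_mono ideal_power_antimono[OF I]) simp_all
    then show ?thesis using assms unfolding 0 ideal_power_0 One_nat_def by blast
  next
    case (Suc m)
    then show ?thesis
      using ideal_power_Suc_subset_subring_add[of m] assms ideal.Icarr[OF I] by blast
  qed
  show ?case
  proof
    fix x assume "x \<in> carrier R"
    then obtain s i where x: "x = s \<oplus> i" "s \<in> S" "i \<in> ideal_power I n"
      using Suc unfolding set_add_def' by blast
    have "s \<oplus> \<zero> \<in> S <+>\<^bsub>R\<^esub> ideal_power I (Suc n)"
      using x(2) ideal_zero_mem[OF ideal_ideal_power[OF I]] unfolding set_add_def' by blast
    then have "s \<in> S <+>\<^bsub>R\<^esub> ideal_power I (Suc n)" using x(2) subringE(1)[OF S] by auto
    then show "x \<in> S <+>\<^bsub>R\<^esub> ideal_power I (Suc n)"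
      unfolding x(1) using x(3) subset by (intro subring_add_ideal_power_closed) blast+
  qed
qed

end

lemma carrier_subset_pow_image_add_if_surj_frobenius_mod:
  assumes I: "ideal I R"
    and surj: "frobenius_mod p R I ` carrier (R Quot I) = carrier (R Quot ideal_power I p)"
  shows "carrier R \<subseteq> (\<lambda>c. c [^] p) ` carrier R <+>\<^bsub>R\<^esub> ideal_power I p"
proof
  let ?Ip = "ideal_power I p"
  have ideal_Ip: "ideal ?Ip R" by (rule ideal_ideal_power[OF I])
  fix z assume z: "z \<in> carrier R"
  then have "?Ip +> z \<in> carrier (R Quot ?Ip)" by (auto simp: FactRing_def A_RCOSETS_def')
  then obtain C where C: "C \<in> carrier (R Quot I)" "?Ip +> z = frobenius_mod p R I C"
    using surj by blast
  have "\<zero> \<oplus> z \<in> ?Ip +> z" using ideal_zero_mem[OF ideal_Ip] by (auto simp: a_r_coset_def')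
  then have "z \<in> frobenius_mod p R I C" using C z by simp
  then obtain c i where c: "c \<in> C" and i: "i \<in> ?Ip" "z = i \<oplus> c [^] p"
    by (auto simp: frobenius_mod_def a_r_coset_def')
  have "C \<subseteq> carrier R"
    using C(1) ideal.Icarr[OF I] by (auto simp: FactRing_def A_RCOSETS_def' a_r_coset_def')
  then have "c \<in> carrier R" using c by blast
  moreover from this have "z = c [^] p \<oplus> i"
    using i ideal.Icarr[OF ideal_Ip] by (simp add: a_comm)
  ultimately show "z \<in> (\<lambda>c. c [^] p) ` carrier R <+>\<^bsub>R\<^esub> ?Ip"
    using i(1) unfolding set_add_def' by blast
qed

end

lemma (in char_p_ring) carrier_subset_frobenius_image_add_ideal_power:
  assumes I: "ideal I B"
    and "carrier B \<subseteq> (\<lambda>c. c [^] p) ` carrier B <+>\<^bsub>B\<^esub> ideal_power I p"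
  shows "carrier B \<subseteq> (\<lambda>c. c [^] p) ` carrier B <+>\<^bsub>B\<^esub> ideal_power I n"
proof (rule carrier_subset_subring_add_ideal_power[OF _ I])
  show "subring ((\<lambda>c. c [^] p) ` carrier B) B"
    by (rule ring_hom_ring.img_is_subring[OF frobenius_ring_hom carrier_is_subring])
  have "(\<lambda>c. c [^] p) ` carrier B <+>\<^bsub>B\<^esub> ideal_power I p \<subseteq>
      (\<lambda>c. c [^] p) ` carrier B <+>\<^bsub>B\<^esub> ideal_power I 2"
    by (intro set_add_mono subset_refl ideal_power_antimono[OF I] prime_ge_2_nat[OF p_prime])
  with assms(2) show "carrier B \<subseteq> (\<lambda>c. c [^] p) ` carrier B <+>\<^bsub>B\<^esub> ideal_power I 2"
    by (rule subset_trans)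
qed

subsection \<open>Normed rings of characteristic \<open>p\<close>\<close>

locale char_p_normed_ring = char_p_ring R p + power_multiplicative_ring R N
  for R :: "('a, 'm) ring_scheme" (structure) and p :: nat and N :: "'a \<Rightarrow> real"
begin

lemma norm_frobenius_diff:
  assumes "x \<in> carrier R" "y \<in> carrier R"
  shows "N (x [^] p \<ominus> y [^] p) = N (x \<ominus> y) ^ p"
  using assms by (simp add: norm_pow flip: frobenius_diff)

lemma frobenius_inj: "inj_on (\<lambda>x. x [^] p) (carrier R)"
proof (rule inj_onI)
  fix x y assume xy: "x \<in> carrier R" "y \<in> carrier R" "x [^] p = y [^] p"
  then have "N (x \<ominus> y) ^ p = 0"
    unfolding norm_frobenius_diff[OF xy(1,2), symmetric] by (simp add: minus_eq r_neg)
  then show "x = y" using xy by (simp add: norm_eq_0_iff)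
qed

lemma MCauchy_if_frobenius_tendsto:
  assumes s: "\<And>n. s n \<in> carrier R" and z: "z \<in> carrier R"
    and lim: "(\<lambda>n. N (z \<ominus> s n [^] p)) \<longlonglongrightarrow> 0"
  shows "metric.MCauchy s"
  unfolding metric.MCauchy_def
proof (intro conjI allI impI)
  show "range s \<subseteq> carrier R" using s by blast
  fix \<epsilon> :: real assume "\<epsilon> > 0"
  then obtain n0 where n0: "\<And>n. n \<ge> n0 \<Longrightarrow> N (z \<ominus> s n [^] p) < \<epsilon> ^ p"
    using order_tendstoD(2)[OF lim, of "\<epsilon> ^ p"] unfolding eventually_sequentially by auto
  have "norm_dist R N (s m) (s n) < \<epsilon>" if "n0 \<le> m" "n0 \<le> n" for m n
  proof -
    have "N (s m [^] p \<ominus> s n [^] p) \<le> max (N (s m [^] p \<ominus> z)) (N (z \<ominus> s n [^] p))"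
      using s z by (intro norm_ultrametric) simp_all
    also have "N (s m [^] p \<ominus> z) = N (z \<ominus> s m [^] p)"
      using s z by (intro norm_diff_commute) simp_all
    also have "max (N (z \<ominus> s m [^] p)) (N (z \<ominus> s n [^] p)) < \<epsilon> ^ p" using n0 that by simp
    finally have "N (s m \<ominus> s n) ^ p < \<epsilon> ^ p" by (simp add: norm_frobenius_diff s)
    then have "N (s m \<ominus> s n) < \<epsilon>" using \<open>\<epsilon> > 0\<close> by (meson less_imp_le power_less_imp_less_base)
    then show ?thesis using s by (simp add: norm_dist_def)
  qed
  then show "\<exists>n0. \<forall>m n. n0 \<le> m \<longrightarrow> n0 \<le> n \<longrightarrow> norm_dist R N (s m) (s n) < \<epsilon>" by blast
qed

lemma frobenius_root_if_approximable:
  assumes complete: "metric.mcomplete" and z: "z \<in> carrier R"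
    and approx: "\<And>r. r > 0 \<Longrightarrow> \<exists>s\<in>carrier R. N (z \<ominus> s [^] p) < r"
  shows "\<exists>l\<in>carrier R. l [^] p = z"
proof -
  have "\<forall>n. \<exists>s. s \<in> carrier R \<and> N (z \<ominus> s [^] p) < inverse (real (Suc n))"
    using approx by (simp add: Bex_def del: of_nat_Suc)
  then obtain s where s: "\<And>n. s n \<in> carrier R"
    and close: "\<And>n. N (z \<ominus> s n [^] p) < inverse (real (Suc n))" by metis
  have powers_lim: "(\<lambda>n. N (z \<ominus> s n [^] p)) \<longlonglongrightarrow> 0"
    using z s close by (intro tendsto_sandwich[OF _ _ tendsto_const LIMSEQ_inverse_real_of_nat])
      (auto simp: norm_nonneg less_imp_le simp del: of_nat_Suc)
  then have "metric.MCauchy s" by (rule MCauchy_if_frobenius_tendsto[OF s z])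
  then obtain l where "limitin metric.mtopology s l sequentially"
    using complete unfolding metric.mcomplete_def by blast
  then have l: "l \<in> carrier R" and "(\<lambda>n. norm_dist R N (s n) l) \<longlonglongrightarrow> 0"
    by (simp_all add: metric.limitin_metric_dist_null)
  then have lim: "(\<lambda>n. N (s n \<ominus> l)) \<longlonglongrightarrow> 0" using s by (simp add: norm_dist_def)
  have "N (z \<ominus> l [^] p) \<le> N (z \<ominus> s n [^] p) + N (s n \<ominus> l) ^ p" for n
  proof -
    have "N (z \<ominus> l [^] p) \<le> max (N (z \<ominus> s n [^] p)) (N (s n [^] p \<ominus> l [^] p))"
      using s l z by (intro norm_ultrametric) simp_all
    also have "\<dots> \<le> N (z \<ominus> s n [^] p) + N (s n [^] p \<ominus> l [^] p)"
      using s l z by (simp add: norm_nonneg)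
    finally show ?thesis by (simp add: norm_frobenius_diff s l)
  qed
  moreover have "(\<lambda>n. N (z \<ominus> s n [^] p) + N (s n \<ominus> l) ^ p) \<longlonglongrightarrow> 0 + 0 ^ p"
    by (intro tendsto_intros powers_lim lim)
  ultimately have "N (z \<ominus> l [^] p) \<le> 0 + 0 ^ p" by (intro LIMSEQ_le_const) auto
  then have "N (z \<ominus> l [^] p) = 0"
    using norm_nonneg[of "z \<ominus> l [^] p"] z l by (simp add: power_0_left)
  then have "z \<ominus> l [^] p = \<zero>" using z l by (simp add: norm_eq_0_iff)
  then show ?thesis using z l by auto
qed

text \<open>Exponents \<open>p\<^sup>k\<close> suffice, and for them powers of sums are sums of powers.\<close>

definition bounded_multipliers :: "'a set \<Rightarrow> 'a set" where
  "bounded_multipliers S = {r \<in> carrier R. \<exists>k C. \<forall>s\<in>S. N (r [^] (p ^ k) \<otimes> s) \<le> C}"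

lemma norm_mult_le:
  assumes "x \<in> carrier R" "y \<in> carrier R" "N y \<le> C"
  shows "N (x \<otimes> y) \<le> N x * C"
  using norm_mult[OF assms(1,2)] mult_left_mono[OF assms(3) norm_nonneg[OF assms(1)]]
  by (rule order_trans)

context
  fixes S :: "'a set"
  assumes S: "S \<subseteq> carrier R"
begin

lemma bounded_multiplier_larger_power:
  assumes r: "r \<in> carrier R" and bound: "\<forall>s\<in>S. N (r [^] (p ^ k) \<otimes> s) \<le> C" and "k \<le> k'"
  shows "\<exists>C'. \<forall>s\<in>S. N (r [^] (p ^ k') \<otimes> s) \<le> C'"
proof (intro exI ballI)
  fix s assume s: "s \<in> S"
  let ?d = "r [^] (p ^ k' - p ^ k)"
  have "p ^ k \<le> p ^ k'" using \<open>k \<le> k'\<close> by (simp add: power_increasing Suc_le_eq)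
  then have "r [^] (p ^ k') = ?d \<otimes> r [^] (p ^ k)" using r by (simp add: nat_pow_mult)
  then have "r [^] (p ^ k') \<otimes> s = ?d \<otimes> (r [^] (p ^ k) \<otimes> s)"
    using r s S by (simp add: m_assoc subset_iff)
  also have "N \<dots> \<le> N ?d * C" using r s S bound by (intro norm_mult_le) auto
  finally show "N (r [^] (p ^ k') \<otimes> s) \<le> N ?d * C" .
qed

lemma bounded_multipliers_add:
  assumes a: "a \<in> bounded_multipliers S" and b: "b \<in> bounded_multipliers S"
  shows "a \<oplus> b \<in> bounded_multipliers S"
proof -
  have carr: "a \<in> carrier R" "b \<in> carrier R" using a b by (simp_all add: bounded_multipliers_def)
  obtain k C l D where "\<forall>s\<in>S. N (a [^] (p ^ k) \<otimes> s) \<le> C" "\<forall>s\<in>S. N (b [^] (p ^ l) \<otimes> s) \<le> D"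
    using a b unfolding bounded_multipliers_def by blast
  then obtain C' D' where bounds: "\<forall>s\<in>S. N (a [^] (p ^ max k l) \<otimes> s) \<le> C'"
      "\<forall>s\<in>S. N (b [^] (p ^ max k l) \<otimes> s) \<le> D'"
    using bounded_multiplier_larger_power carr by (meson max.cobounded1 max.cobounded2)
  have "N ((a \<oplus> b) [^] (p ^ max k l) \<otimes> s) \<le> max C' D'" if s: "s \<in> S" for s
  proof -
    have "(a \<oplus> b) [^] (p ^ max k l) \<otimes> s = a [^] (p ^ max k l) \<otimes> s \<oplus> b [^] (p ^ max k l) \<otimes> s"
      using carr s S by (simp add: frobenius_power_add l_distr subset_iff)
    also have "N \<dots> \<le> max (N (a [^] (p ^ max k l) \<otimes> s)) (N (b [^] (p ^ max k l) \<otimes> s))"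
      using carr s S by (intro norm_add) auto
    also have "\<dots> \<le> max C' D'" using bounds s by (intro max.mono) simp_all
    finally show ?thesis .
  qed
  then show ?thesis using carr unfolding bounded_multipliers_def by blast
qed

lemma bounded_multipliers_mult:
  assumes a: "a \<in> bounded_multipliers S" and x: "x \<in> carrier R"
  shows "x \<otimes> a \<in> bounded_multipliers S"
proof -
  obtain k C where carr: "a \<in> carrier R" and bound: "\<forall>s\<in>S. N (a [^] (p ^ k) \<otimes> s) \<le> C"
    using a unfolding bounded_multipliers_def by blast
  have "N ((x \<otimes> a) [^] (p ^ k) \<otimes> s) \<le> N (x [^] (p ^ k)) * C" if s: "s \<in> S" for s
  proof -
    have "(x \<otimes> a) [^] (p ^ k) \<otimes> s = x [^] (p ^ k) \<otimes> (a [^] (p ^ k) \<otimes> s)"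
      using carr x s S by (simp add: nat_pow_distrib m_assoc subset_iff)
    also have "N \<dots> \<le> N (x [^] (p ^ k)) * C" using carr x s S bound by (intro norm_mult_le) auto
    finally show ?thesis .
  qed
  then show ?thesis using carr x unfolding bounded_multipliers_def by blast
qed

lemma ideal_bounded_multipliers: "ideal (bounded_multipliers S) R"
proof (rule idealI[OF ring_axioms])
  show "subgroup (bounded_multipliers S) (add_monoid R)"
  proof (rule add.subgroupI)
    show "bounded_multipliers S \<subseteq> carrier R" by (simp add: bounded_multipliers_def)
    have "\<zero> \<in> bounded_multipliers S"
      unfolding bounded_multipliers_def using S by (auto intro!: exI[of _ 0] simp: subset_iff)
    then show "bounded_multipliers S \<noteq> {}" by blast
    fix a assume a: "a \<in> bounded_multipliers S"
    have "\<ominus> \<one> \<otimes> a \<in> bounded_multipliers S" by (rule bounded_multipliers_mult[OF a]) simp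
    then show "\<ominus> a \<in> bounded_multipliers S" using a by (simp add: l_minus bounded_multipliers_def)
  qed (simp add: bounded_multipliers_add)
  fix a x assume a: "a \<in> bounded_multipliers S" and x: "x \<in> carrier R"
  then show "x \<otimes> a \<in> bounded_multipliers S" by (rule bounded_multipliers_mult)
  then show "a \<otimes> x \<in> bounded_multipliers S" using a x by (simp add: m_comm bounded_multipliers_def)
qed

end

lemma topologically_nilpotent_subset_bounded_multipliers:
  assumes bounded: "bounded_in R (norm_topology R N) S"
  shows "topologically_nilpotent_elements R (norm_topology R N) \<subseteq> bounded_multipliers S"
proof
  let ?T = "norm_topology R N"
  fix t assume "t \<in> topologically_nilpotent_elements R ?T"
  then have t: "t \<in> carrier R" and lim: "limitin ?T (\<lambda>n::nat. t [^] n) \<zero> sequentially"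
    by (auto simp: topologically_nilpotent_elements_def)
  have "openin ?T {y \<in> carrier R. N y < 1} \<and> \<zero> \<in> {y \<in> carrier R. N y < 1}"
    using openin_norm_ball by simp
  then obtain V where V: "openin ?T V" "\<zero> \<in> V"
    and VS: "\<And>v s. v \<in> V \<Longrightarrow> s \<in> S \<Longrightarrow> v \<otimes> s \<in> {y \<in> carrier R. N y < 1}"
    using bounded unfolding bounded_in_def by meson
  obtain n where "\<And>m. m \<ge> n \<Longrightarrow> t [^] (m::nat) \<in> V"
    using lim V unfolding limitin_def eventually_sequentially by blast
  then have "t [^] (p ^ n) \<in> V" using le_prime_power by blast
  then have "\<forall>s\<in>S. N (t [^] (p ^ n) \<otimes> s) \<le> 1" using VS by fastforce
  then show "t \<in> bounded_multipliers S" using t unfolding bounded_multipliers_def by blast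
qed

lemma norm_bounded_if_bounded_in:
  assumes analytic: "analytic_ring R (norm_topology R N)"
    and bounded: "bounded_in R (norm_topology R N) S"
  shows "\<exists>C. \<forall>s\<in>S. N s \<le> C"
proof -
  have S: "S \<subseteq> carrier R" using bounded by (simp add: bounded_in_def)
  have "Idl (topologically_nilpotent_elements R (norm_topology R N)) \<subseteq> bounded_multipliers S"
    by (intro genideal_minimal ideal_bounded_multipliers S
        topologically_nilpotent_subset_bounded_multipliers bounded)
  then have "\<one> \<in> bounded_multipliers S" using analytic by (auto simp: analytic_ring_def)
  then obtain k C where "\<forall>s\<in>S. N (\<one> [^] (p ^ k) \<otimes> s) \<le> C" unfolding bounded_multipliers_def by blast
  then have "\<forall>s\<in>S. N s \<le> C" using S by (auto simp: subset_iff)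
  then show ?thesis ..
qed

lemma norm_le_1_if_power_bounded:
  assumes "analytic_ring R (norm_topology R N)" "x \<in> power_bounded_elements R (norm_topology R N)"
  shows "N x \<le> 1"
proof -
  have x: "x \<in> carrier R" and "bounded_in R (norm_topology R N) (range (\<lambda>n::nat. x [^] n))"
    using assms(2) by (simp_all add: power_bounded_elements_def)
  then obtain C where "\<forall>y\<in>range (\<lambda>n::nat. x [^] n). N y \<le> C"
    using norm_bounded_if_bounded_in[OF assms(1)] by blast
  then show ?thesis by (intro norm_le_1_if_powers_bounded[OF x]) blast
qed

end

subsection \<open>Perfectoid pairs\<close>

lemma (in cring) integral_over_if_pow_mem:
  fixes n :: nat
  assumes "subring A R" "x \<in> carrier R" "x [^] n \<in> A" "0 < n"
  shows "integral_over R A x"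
  unfolding integral_over_def
proof (intro exI conjI allI impI)
  let ?c = "\<lambda>i. if 0 = i then \<ominus> (x [^] n) else \<zero>"
  show "?c i \<in> A" for i using assms(1,3) by (simp add: subringE)
  have "(\<Oplus>i\<in>{..<n}. ?c i \<otimes> x [^] i) = (\<Oplus>i\<in>{..<n}. if 0 = i then \<ominus> (x [^] n) else \<zero>)"
    using assms(2) by (intro finsum_cong') auto
  also have "\<dots> = \<ominus> (x [^] n)"
    using assms(2,4) by (intro add.finprod_singleton) auto
  finally show "x [^] n \<oplus> (\<Oplus>i\<in>{..<n}. ?c i \<otimes> x [^] i) = \<zero>"
    using assms(2) by (simp add: r_neg)
qed

lemma (in ring) minus_subring_eq:
  assumes "subring H R" "y \<in> H"
  shows "x \<ominus>\<^bsub>restrict_ring R H\<^esub> y = x \<ominus> y"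
  using add.m_inv_consistent[OF subring.axioms(1)[OF assms(1)] assms(2)]
  by (simp add: a_minus_def a_inv_def)

locale normed_perfectoid_pair =
  fixes p :: nat and R :: "('a, 'm) ring_scheme" (structure) and T :: "'a topology"
    and Rplus :: "'a set" and N :: "'a \<Rightarrow> real"
  assumes p_prime: "Factorial_Ring.prime p"
    and perfectoid: "analytic_perfectoid_pair p R T Rplus"
    and char_p: "add_pow R p \<one> = \<zero>"
    and banach: "banach_ring_norm R N" and power_mult: "power_multiplicative_norm R N"
    and topology: "norm_topology R N = T"
begin

abbreviation B :: "('a, 'm) ring_scheme" where "B \<equiv> restrict_ring R Rplus"

lemma huber: "huber_pair R T Rplus"
  using perfectoid by (simp add: analytic_perfectoid_pair_def)

lemma cring_R: "cring R"
  using huber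
  by (simp add: huber_pair_def huber_ring_def complete_topological_cring_def topological_cring_def)

lemma char_p_normed_ring_R: "char_p_normed_ring R p N"
proof -
  interpret cring R by (rule cring_R)
  show ?thesis
    by unfold_locales
      (use p_prime char_p banach power_mult in
        \<open>simp_all add: banach_ring_norm_def power_multiplicative_norm_def\<close>)
qed

sublocale R: char_p_normed_ring R p N by (rule char_p_normed_ring_R)

lemma mcomplete: "R.metric.mcomplete"
  using banach by (simp add: banach_ring_norm_def)

lemma subring_Rplus: "subring Rplus R" and openin_Rplus: "openin (norm_topology R N) Rplus"
  and Rplus_integrally_closed: "x \<in> carrier R \<Longrightarrow> integral_over R Rplus x \<Longrightarrow> x \<in> Rplus"
  using huber by (simp_all add: huber_pair_def topology)

lemma Rplus_carrier: "x \<in> Rplus \<Longrightarrow> x \<in> carrier R"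
  using subringE(1)[OF subring_Rplus] by blast

lemma norm_Rplus_le_1:
  assumes "x \<in> Rplus"
  shows "N x \<le> 1"
  using perfectoid huber assms
  by (intro R.norm_le_1_if_power_bounded)
    (auto simp: topology analytic_perfectoid_pair_def huber_pair_def)

lemma cring_B: "cring B"
  using R.subcring_iff[of Rplus] R.subcringI'[OF subring_Rplus] Rplus_carrier by blast

lemma pow_B: "x [^]\<^bsub>B\<^esub> (k::nat) = x [^] k"
  by (simp add: nat_pow_def)

lemma minus_B: "y \<in> Rplus \<Longrightarrow> x \<ominus>\<^bsub>B\<^esub> y = x \<ominus> y"
  by (rule R.minus_subring_eq[OF subring_Rplus])

lemma minus_zero_B: "y \<in> Rplus \<Longrightarrow> y \<ominus>\<^bsub>B\<^esub> \<zero> = y"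
  by (simp add: minus_B subringE(2)[OF subring_Rplus] R.minus_eq Rplus_carrier)

lemma char_p_normed_ring_B: "char_p_normed_ring B p N"
proof -
  interpret cring B by (rule cring_B)
  have "add_pow B p \<one>\<^bsub>B\<^esub> = \<zero>\<^bsub>B\<^esub>" using char_p by (simp add: add_pow_def nat_pow_def)
  then show ?thesis
    by unfold_locales
      (use p_prime in \<open>simp_all add: pow_B minus_B Rplus_carrier R.norm_nonneg R.norm_eq_0_iff
        R.norm_diff R.norm_mult R.norm_pow\<close>)
qed

sublocale B: char_p_normed_ring B p N by (rule char_p_normed_ring_B)

context
  fixes I :: "'a set"
  assumes I: "ideal_of_definition R T Rplus I"
begin

lemma ideal_of_definition_ideal: "ideal I B"
  using I unfolding ideal_of_definition_def fg_ideal_def using B.genideal_ideal by blast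

lemma subtopology_Rplus_eq: "subtopology (norm_topology R N) Rplus = adic_topology B I"
  using I by (simp add: ideal_of_definition_def topology)

lemma ideal_of_definition_contains_ball:
  obtains \<delta> where "\<delta> > 0" "\<And>b. b \<in> Rplus \<Longrightarrow> N b < \<delta> \<Longrightarrow> b \<in> I"
proof -
  note ideal_I = ideal_of_definition_ideal
  have "openin (adic_topology B I) {y \<in> carrier B. y \<ominus>\<^bsub>B\<^esub> \<zero>\<^bsub>B\<^esub> \<in> B.ideal_power I 1}"
    by (rule B.openin_adic_coset[OF ideal_I B.zero_closed])
  also have "{y \<in> carrier B. y \<ominus>\<^bsub>B\<^esub> \<zero>\<^bsub>B\<^esub> \<in> B.ideal_power I 1} = I"
    unfolding B.ideal_power_1[OF ideal_I] using ideal.Icarr[OF ideal_I] by (auto simp: minus_zero_B)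
  finally have "openin (norm_topology R N) I"
    unfolding subtopology_Rplus_eq[symmetric] using openin_Rplus openin_trans_full by blast
  moreover have "\<zero> \<in> I" using B.ideal_zero_mem[OF ideal_I] by simp
  ultimately obtain r where "r > 0" "\<And>y. y \<in> carrier R \<Longrightarrow> N y < r \<Longrightarrow> y \<in> I"
    by (rule R.openin_norm_topology_zero) blast
  then show ?thesis using that Rplus_carrier by blast
qed

lemma ideal_of_definition_power_small:
  assumes "r > 0"
  obtains n where "\<And>w. w \<in> B.ideal_power I n \<Longrightarrow> N w < r"
proof -
  note ideal_I = ideal_of_definition_ideal
  let ?U = "Rplus \<inter> {y \<in> carrier R. N y < r}"
  have "openin (adic_topology B I) ?U"
    unfolding subtopology_Rplus_eq[symmetric] by (intro openin_subtopology_Int2 R.openin_norm_ball)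
  moreover have "\<zero>\<^bsub>B\<^esub> \<in> ?U" using subringE(2)[OF subring_Rplus] \<open>r > 0\<close> by simp
  ultimately obtain n where coset_subset:
      "\<forall>y\<in>carrier B. y \<ominus>\<^bsub>B\<^esub> \<zero>\<^bsub>B\<^esub> \<in> B.ideal_power I n \<longrightarrow> y \<in> ?U"
    unfolding B.openin_adic_topology[OF ideal_I] by blast
  have "N w < r" if w: "w \<in> B.ideal_power I n" for w
    using coset_subset[rule_format, of w] w B.ideal_power_closed[OF ideal_I w]
    by (simp add: minus_zero_B)
  then show ?thesis by (rule that)
qed

lemma norm_less_1_if_mem_ideal_of_definition:
  assumes "y \<in> I"
  shows "N y < 1"
proof -
  obtain n where power_small: "\<And>w. w \<in> B.ideal_power I n \<Longrightarrow> N w < 1"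
    by (rule ideal_of_definition_power_small[OF zero_less_one]) blast
  have y: "y \<in> carrier B" using ideal_of_definition_ideal assms by (rule ideal.Icarr)
  have "y [^]\<^bsub>B\<^esub> Suc n \<in> B.ideal_power I (Suc n)"
    by (rule B.pow_mem_ideal_power[OF ideal_of_definition_ideal assms])
  also have "\<dots> \<subseteq> B.ideal_power I n" by (intro B.ideal_power_antimono ideal_of_definition_ideal) simp
  finally have "N (y [^]\<^bsub>B\<^esub> Suc n) < 1" by (rule power_small)
  then have "N y ^ Suc n < 1" using B.norm_pow[OF y, of "Suc n"] by (simp only: zero_less_Suc)
  then show ?thesis using one_le_power[of "N y" "Suc n"] by (meson not_le)
qed

lemma frobenius_approximation:
  assumes surj: "frobenius_mod p B I ` carrier (B Quot I) = carrier (B Quot B.ideal_power I p)"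
    and z: "z \<in> Rplus" and "r > 0"
  shows "\<exists>s\<in>carrier R. N (z \<ominus> s [^] p) < r"
proof -
  note ideal_I = ideal_of_definition_ideal
  obtain n where power_small: "\<And>w. w \<in> B.ideal_power I n \<Longrightarrow> N w < r"
    by (rule ideal_of_definition_power_small[OF \<open>r > 0\<close>]) blast
  have "carrier B \<subseteq> (\<lambda>c. c [^]\<^bsub>B\<^esub> p) ` carrier B <+>\<^bsub>B\<^esub> B.ideal_power I n"
    by (rule B.carrier_subset_frobenius_image_add_ideal_power[OF ideal_I
          B.carrier_subset_pow_image_add_if_surj_frobenius_mod[OF ideal_I surj]])
  then obtain s i where s: "s \<in> Rplus" "z = s [^] p \<oplus> i" and i: "i \<in> B.ideal_power I n"
    using z unfolding set_add_def' by (auto simp: pow_B)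
  have carrier: "s \<in> carrier R" "i \<in> carrier R"
    using s(1) B.ideal_power_closed[OF ideal_I i] by (simp_all add: Rplus_carrier)
  then have "z \<ominus> s [^] p = i" unfolding s(2) by (simp add: R.minus_eq R.a_ac R.r_neg R.r_neg2)
  then show ?thesis using power_small[OF i] carrier by auto
qed

end

lemma frobenius_surj_Rplus:
  assumes z: "z \<in> Rplus"
  shows "\<exists>l\<in>Rplus. l [^] p = z"
proof -
  obtain I where "ideal_of_definition R T Rplus I"
    and "frobenius_mod p B I ` carrier (B Quot I) = carrier (B Quot (B.ideal_power I p))"
    using perfectoid unfolding analytic_perfectoid_pair_def Let_def by blast
  then have "\<exists>l\<in>carrier R. l [^] p = z"
    using z
    by (intro R.frobenius_root_if_approximable mcomplete Rplus_carrier frobenius_approximation)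
  then obtain l where l: "l \<in> carrier R" "l [^] p = z" by blast
  then have "integral_over R Rplus l"
    using z by (intro R.integral_over_if_pow_mem[of _ _ p] subring_Rplus) simp_all
  then show ?thesis using l Rplus_integrally_closed by blast
qed

lemma perfect_normed_ring_B:
  assumes "0 < \<rho>" "\<rho> < 1"
  shows "perfect_normed_ring B p N \<rho>"
proof
  have "(\<lambda>x. x [^]\<^bsub>B\<^esub> p) ` carrier B = carrier B"
    using frobenius_surj_Rplus B.nat_pow_closed[of _ p] by (auto simp: pow_B image_iff Bex_def)
  then show "bij_betw (\<lambda>x. x [^]\<^bsub>B\<^esub> p) (carrier B) (carrier B)"
    using B.frobenius_inj by (simp add: bij_betw_def)
qed (use assms norm_Rplus_le_1 in simp_all)

end

theorem corollary5p6:
  fixes p :: nat and R :: "('a, 'm) ring_scheme" and T :: "'a topology" and Rplus :: "'a set"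
    and N :: "'a \<Rightarrow> real" and m :: nat and x :: "nat \<Rightarrow> 'a" and \<rho> :: real
  assumes "Factorial_Ring.prime p"
    and "analytic_perfectoid_pair p R T Rplus"
    and "add_pow R p \<one>\<^bsub>R\<^esub> = \<zero>\<^bsub>R\<^esub>"
    and "banach_ring_norm R N" and "power_multiplicative_norm R N" and "norm_topology R N = T"
    and "\<forall>i\<le>m. x i \<in> Rplus"
    and "ideal_of_definition R T Rplus (Idl\<^bsub>restrict_ring R Rplus\<^esub> (x ` {..m}))"
    and "0 < \<rho>" and "\<rho> < 1"
  shows "let B = restrict_ring R Rplus; W = witt_ring p B; G = gauss_norm p B N \<rho> in
           Metric_space (carrier W) (norm_dist W G) \<and>
           norm_topology W G =
             adic_topology W
               (Idl\<^bsub>W\<^esub> ({add_pow W p \<one>\<^bsub>W\<^esub>} \<union> (\<lambda>i. teichmuller B (x i)) ` {..m}))"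
proof -
  interpret P: normed_perfectoid_pair p R T Rplus N
    using assms(1-6) by unfold_locales
  interpret G: perfect_normed_ring "restrict_ring R Rplus" p N \<rho>
    using assms(9,10) by (rule P.perfect_normed_ring_B)
  let ?I = "Idl\<^bsub>P.B\<^esub> (x ` {..m})" and ?W = "witt_ring p P.B"
  have generators: "x ` {..m} \<subseteq> carrier P.B" using assms(7) by auto
  have less_1: "N y < 1" if "y \<in> x ` {..m}" for y
    using P.norm_less_1_if_mem_ideal_of_definition[OF assms(8)] P.B.genideal_self[OF generators]
      that by blast
  obtain \<delta> where "\<delta> > 0" "\<And>b. b \<in> Rplus \<Longrightarrow> N b < \<delta> \<Longrightarrow> b \<in> ?I"
    by (rule P.ideal_of_definition_contains_ball[OF assms(8)]) blast
  then have "norm_topology ?W (gauss_norm p P.B N \<rho>) =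
      adic_topology ?W (G.p_teichmuller_ideal (x ` {..m}))"
    using generators less_1 by (intro G.gauss_norm_topology_eq_adic_topology) simp_all
  then show ?thesis
    using G.gauss.metric.Metric_space_axioms
    by (simp add: G.p_teichmuller_ideal_def image_image Let_def)
qed

end
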